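(* Let $g\colon\mathbb{N}\to\mathbb{N}$ be a right-c.e. function such that $\mathrm{K}(n)\le g(n)+O(1)$ but $g$ is not a weak Solovay function. Then the set of sequences $A\in2^\omega$ for which there is a constant $c$ with $\mathrm{K}(A\upharpoonright n)\le g(n)+c$ for all $n$ is uncountable.
   Context: $\mathrm{K}$ denotes prefix-free Kolmogorov complexity; $A\upharpoonright n$ is the length-$n$ prefix of $A$. A function is right-c.e. if it is the pointwise limit of a computable nonincreasing approximation. A weak Solovay function is a right-c.e. function $g$ with $\mathrm{K}(n)\le g(n)+O(1)$ for all $n$ and $g(n)\le\mathrm{K}(n)+O(1)$ for infinitely many $n$. *)

theory Defs
  imports Complex_Main "HOL-Library.Sublist" "HOL-Library.Countable_Set"
begin

section \<open>Partial recursive functions\<close>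

text \<open>Kleene's schemes. Programs carry no arity: a program is undefined on argument lists that do not fit
  it.\<close>

datatype recf =
    Zero
  | Succ
  | Proj nat
  | Comp recf "recf list"
  | PrimRec recf recf
  | Mu recf

inductive evaluates :: "recf \<Rightarrow> nat list \<Rightarrow> nat \<Rightarrow> bool" where
  "evaluates Zero xs 0"
| "evaluates Succ [x] (Suc x)"
| "i < length xs \<Longrightarrow> evaluates (Proj i) xs (xs ! i)"
| "list_all2 (\<lambda>g y. evaluates g xs y) gs ys \<Longrightarrow> evaluates f ys z \<Longrightarrow> evaluates (Comp f gs) xs z"
| "evaluates f xs y \<Longrightarrow> evaluates (PrimRec f g) (0 # xs) y"
| "evaluates (PrimRec f g) (n # xs) r \<Longrightarrow> evaluates g (n # r # xs) y \<Longrightarrow> evaluates (PrimRec f g) (Suc n # xs) y"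
| "evaluates f (n # xs) 0 \<Longrightarrow> (\<forall>m<n. \<exists>y. evaluates f (m # xs) (Suc y)) \<Longrightarrow> evaluates (Mu f) xs n"

definition partial_recursive :: "nat \<Rightarrow> (nat list \<Rightarrow> nat option) \<Rightarrow> bool" where
  "partial_recursive k \<phi> \<longleftrightarrow>
     (\<exists>f. \<forall>xs. length xs = k \<longrightarrow> (\<forall>y. evaluates f xs y \<longleftrightarrow> \<phi> xs = Some y))"

definition computable2 :: "(nat \<Rightarrow> nat \<Rightarrow> nat) \<Rightarrow> bool" where
  "computable2 h \<longleftrightarrow> partial_recursive 2 (\<lambda>xs. Some (h (xs ! 0) (xs ! 1)))"


section \<open>Binary strings and numbers\<close>

text \<open>The position of a string in the length-lexicographic enumeration
  \<open>\<epsilon>, 0, 1, 00, 01, 10, 11, 000, \<dots>\<close> of all binary strings.\<close>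

definition str_code :: "bool list \<Rightarrow> nat" where
  "str_code s = foldl (\<lambda>n b. 2 * n + (if b then 2 else 1)) 0 s"

lemma str_code_Nil: "str_code [] = 0"
  by (simp add: str_code_def)

lemma str_code_snoc: "str_code (s @ [b]) = 2 * str_code s + (if b then 2 else 1)"
  by (simp add: str_code_def)

lemma bij_str_code: "bij str_code"
proof (rule bijI)
  show "inj str_code"
  proof (rule injI)
    fix s t assume "str_code s = str_code t"
    then show "s = t"
    proof (induction s arbitrary: t rule: rev_induct)
      case Nil
      then show ?case
        by (cases t rule: rev_cases) (auto simp: str_code_Nil str_code_snoc split: if_splits)
    next
      case (snoc b s)
      show ?case
      proof (cases t rule: rev_cases)
        case Nil
        with snoc.prems show ?thesis by (simp add: str_code_Nil str_code_snoc split: if_splits)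
      next
        case (snoc t' b')
        with snoc.prems have "2 * str_code s + (if b then 2 else 1)
            = 2 * str_code t' + (if b' then 2 else 1)"
          by (simp add: str_code_snoc)
        then have "b = b' \<and> str_code s = str_code t'"
          by (cases b; cases b') (simp_all, presburger+)
        with snoc.IH snoc show ?thesis by simp
      qed
    qed
  qed
  show "surj str_code"
  proof -
    have "\<exists>s. str_code s = n" for n
    proof (induction n rule: less_induct)
      case (less n)
      show ?case
      proof (cases "n = 0")
        case True
        then show ?thesis using str_code_Nil by blast
      next
        case False
        then have "(n - 1) div 2 < n" by linarith
        then obtain s where s: "str_code s = (n - 1) div 2" using less.IH[of "(n - 1) div 2"] by blast
        have "2 * ((n - 1) div 2) + (if even n then 2 else 1) = n"
          using False by presburger
        then have "str_code (s @ [even n]) = n" by (simp add: str_code_snoc s)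
        then show ?thesis by blast
      qed
    qed
    then show ?thesis by (metis surjI)
  qed
qed

definition nat_str :: "nat \<Rightarrow> bool list" where
  "nat_str = inv str_code"

definition initial_segment :: "(nat \<Rightarrow> bool) \<Rightarrow> nat \<Rightarrow> bool list" where
  "initial_segment A n = map A [0..<n]"


section \<open>Prefix-free Kolmogorov complexity\<close>

type_synonym machine = "bool list \<Rightarrow> bool list option"

definition prefix_free_machine :: "machine \<Rightarrow> bool" where
  "prefix_free_machine M \<longleftrightarrow>
     partial_recursive 1 (\<lambda>xs. map_option str_code (M (nat_str (xs ! 0)))) \<and>
     (\<forall>p\<in>dom M. \<forall>q\<in>dom M. prefix p q \<longrightarrow> p = q)"

definition optimal_prefix_free_machine :: "machine \<Rightarrow> bool" where
  "optimal_prefix_free_machine U \<longleftrightarrow>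
     prefix_free_machine U \<and>
     (\<forall>M. prefix_free_machine M \<longrightarrow>
        (\<exists>c. \<forall>p s. M p = Some s \<longrightarrow> (\<exists>q. U q = Some s \<and> length q \<le> length p + c)))"

text \<open>An optimal machine has every string in its range, so the minimum exists for the machines of
  interest.\<close>

definition K :: "machine \<Rightarrow> bool list \<Rightarrow> nat" where
  "K U s = (LEAST k. \<exists>p. U p = Some s \<and> length p = k)"

definition K_nat :: "machine \<Rightarrow> nat \<Rightarrow> nat" where
  "K_nat U n = K U (nat_str n)"


section \<open>Weak Solovay functions\<close>

text \<open>On \<^typ>\<open>nat\<close> the topology is discrete, so the limit means that the approximation is
  eventually equal to its limit.\<close>

definition right_ce :: "(nat \<Rightarrow> nat) \<Rightarrow> bool" where
  "right_ce g \<longleftrightarrow>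
     (\<exists>h. computable2 h \<and> (\<forall>n. decseq (h n)) \<and> (\<forall>n. h n \<longlonglongrightarrow> g n))"

definition weak_solovay :: "machine \<Rightarrow> (nat \<Rightarrow> nat) \<Rightarrow> bool" where
  "weak_solovay U g \<longleftrightarrow>
     right_ce g \<and>
     (\<exists>c. \<forall>n. K_nat U n \<le> g n + c) \<and>
     (\<exists>c. infinite {n. g n \<le> K_nat U n + c})"

end

(* Let h n s decrease to g n and let alpha s be the sum of 2^(-h n s) over n < s. Since K n <= g n + O(1),
   alpha is bounded. Put movable markers m_0, m_1, ... on the natural numbers and request, for every
   string with ones only at current markers, a program of length g n + O(1); a marker that is reset jumps
   beyond all strings treated so far, so nothing has to be requested again. The cost of keeping marker i
   is 2^i times the growth of alpha since its last reset, and the marker is kept as long as this growth is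
   covered by 4^(-i) times the growth of beta_i between its last two resets. Here beta_i approximates the
   sum of 2^(-K n) with the terms held down to 2^(2i+1-h n s), and is bounded by Kraft's inequality, so
   the total cost is finite. As g is not a weak Solovay function, g n >= K n + 2i+1 for almost all n, so
   eventually beta_i still has to grow 2 * 4^i times as much as alpha: infinitely many resets of marker i
   are impossible. All subsets of the infinite set of limit markers then satisfy the bound. *)

theory Submission
  imports Defs "HOL-Library.Nat_Bijection"
begin

section \<open>Recursive functions\<close>

text \<open>If k markers lie below n, up to 2^k strings of length n have to be paid for, which takes
  about k bits of the gap between g n and K n. The gap tends to infinity, but nothing effective is
  known about when it passes a given value; so no marker can be placed once and for all, and keeping
  one in place is a bet. The bet is covered by the growth of \<open>\<beta> i\<close> between the
  two previous resets, not since the last one: that amount is fixed before the bet starts, and as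
  these intervals do not overlap, each part of the total weight (at most 1) is spent once. The
  scaling 4^(-i) then bounds the cost of marker i by a constant times 2^i * 4^(-i), which is
  summable; 2^(-i) would give only a constant per marker. The scaling uses up 2 i bits of the gap,
  and the extra bit in 2 i + 1 leaves a factor 2: infinitely many resets would bound twice the
  remaining growth of alpha by that growth itself.\<close>

lemma evaluates_deterministic: "evaluates f xs y \<Longrightarrow> evaluates f xs z \<Longrightarrow> y = z"
proof (induction arbitrary: z rule: evaluates.induct)
  case (1 xs)
  then show ?case by (cases rule: evaluates.cases) auto
next
  case (2 x)
  then show ?case by (cases rule: evaluates.cases) auto
next
  case (3 i xs)
  from 3(2) show ?case by (cases rule: evaluates.cases) auto
next
  case (4 xs gs ys f z z')
  from \<open>evaluates (Comp f gs) xs z'\<close> obtain ys'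
    where ys': "list_all2 (\<lambda>g y. evaluates g xs y) gs ys'" "evaluates f ys' z'"
    by (cases rule: evaluates.cases) auto
  have "ys = ys'"
    using 4(1) ys'(1) by (auto simp: list_all2_conv_all_nth intro!: nth_equalityI)
  with 4 ys' show ?case by blast
next
  case (5 f xs y g)
  from 5(3) show ?case by (cases rule: evaluates.cases) (auto dest: 5(2))
next
  case (6 f g n xs r y)
  from 6(5) obtain r' where "evaluates (PrimRec f g) (n # xs) r'" "evaluates g (n # r' # xs) z"
    by (cases rule: evaluates.cases) auto
  with 6 show ?case by blast
next
  case (7 f n xs)
  from \<open>evaluates (Mu f) xs z\<close>
  have z: "evaluates f (z # xs) 0" "\<forall>m<z. \<exists>y. evaluates f (m # xs) (Suc y)"
    by (cases rule: evaluates.cases; auto)+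
  show ?case
  proof (rule linorder_cases[of n z])
    assume "n < z"
    then obtain y where "evaluates f (n # xs) (Suc y)" using z by blast
    with 7(2) have False by blast
    then show ?thesis ..
  next
    assume "z < n"
    then obtain y where "\<forall>w. evaluates f (z # xs) w \<longrightarrow> Suc y = w" using 7(3) by blast
    with z have False by blast
    then show ?thesis ..
  qed
qed

definition recursive :: "nat \<Rightarrow> (nat list \<Rightarrow> nat) \<Rightarrow> bool" where
  "recursive k F \<longleftrightarrow> (\<exists>e. \<forall>xs. length xs = k \<longrightarrow> evaluates e xs (F xs))"

lemma recursive_cong:
  "recursive k F \<Longrightarrow> (\<And>xs. length xs = k \<Longrightarrow> F xs = G xs) \<Longrightarrow> recursive k G"
  unfolding recursive_def by metis

lemma recursive_nth: "i < k \<Longrightarrow> recursive k (\<lambda>xs. xs ! i)"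
  unfolding recursive_def by (metis evaluates.intros(3))

lemma recursive_zero: "recursive k (\<lambda>xs. 0)"
  unfolding recursive_def by (metis evaluates.intros(1))

lemma recursive_comp1:
  assumes "recursive 1 (\<lambda>xs. f (xs ! 0))" "recursive k G"
  shows "recursive k (\<lambda>xs. f (G xs))"
proof -
  obtain e where e: "\<And>xs. length xs = 1 \<Longrightarrow> evaluates e xs (f (xs ! 0))"
    using assms(1) unfolding recursive_def by blast
  obtain e' where e': "\<And>xs. length xs = k \<Longrightarrow> evaluates e' xs (G xs)"
    using assms(2) unfolding recursive_def by blast
  have "evaluates (Comp e [e']) xs (f (G xs))" if "length xs = k" for xs
    using e[of "[G xs]"] e'[OF that] by (intro evaluates.intros(4)[where ys = "[G xs]"]) auto
  then show ?thesis unfolding recursive_def by blast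
qed

lemma recursive_comp2:
  assumes "recursive 2 (\<lambda>xs. f (xs ! 0) (xs ! 1))" "recursive k G" "recursive k H"
  shows "recursive k (\<lambda>xs. f (G xs) (H xs))"
proof -
  obtain e where e: "\<And>xs. length xs = 2 \<Longrightarrow> evaluates e xs (f (xs ! 0) (xs ! 1))"
    using assms(1) unfolding recursive_def by blast
  obtain e' where e': "\<And>xs. length xs = k \<Longrightarrow> evaluates e' xs (G xs)"
    using assms(2) unfolding recursive_def by blast
  obtain e'' where e'': "\<And>xs. length xs = k \<Longrightarrow> evaluates e'' xs (H xs)"
    using assms(3) unfolding recursive_def by blast
  have "evaluates (Comp e [e', e'']) xs (f (G xs) (H xs))" if "length xs = k" for xs
    using e[of "[G xs, H xs]"] e'[OF that] e''[OF that]
    by (intro evaluates.intros(4)[where ys = "[G xs, H xs]"]) auto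
  then show ?thesis unfolding recursive_def by blast
qed

lemma recursive_Suc: "recursive k G \<Longrightarrow> recursive k (\<lambda>xs. Suc (G xs))"
proof (rule recursive_comp1[of Suc])
  have "evaluates Succ xs (Suc (xs ! 0))" if "length xs = 1" for xs
    using that evaluates.intros(2) by (cases xs) auto
  then show "recursive 1 (\<lambda>xs. Suc (xs ! 0))"
    unfolding recursive_def by blast
qed

lemma recursive_const: "recursive k (\<lambda>xs. c)"
  by (induction c) (auto intro: recursive_zero recursive_Suc)

lemma recursive_rec_nat:
  assumes "recursive k a" "recursive (Suc (Suc k)) (\<lambda>ys. h (ys ! 0) (ys ! 1) (drop 2 ys))"
    "recursive k e"
  shows "recursive k (\<lambda>xs. rec_nat (a xs) (\<lambda>n r. h n r xs) (e xs))"
proof -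
  obtain A where A: "\<And>xs. length xs = k \<Longrightarrow> evaluates A xs (a xs)"
    using assms(1) unfolding recursive_def by blast
  obtain H where "\<And>ys. length ys = Suc (Suc k) \<Longrightarrow> evaluates H ys (h (ys ! 0) (ys ! 1) (drop 2 ys))"
    using assms(2) unfolding recursive_def by blast
  from this[of "_ # _ # _"] have H: "length xs = k \<Longrightarrow> evaluates H (n # r # xs) (h n r xs)" for n r xs
    by simp
  obtain E where E: "\<And>xs. length xs = k \<Longrightarrow> evaluates E xs (e xs)"
    using assms(3) unfolding recursive_def by blast
  have P: "evaluates (PrimRec A H) (n # xs) (rec_nat (a xs) (\<lambda>n r. h n r xs) n)"
    if "length xs = k" for n xs
    by (induction n) (auto intro: evaluates.intros A[OF that] H[OF that])
  have "evaluates (Comp (PrimRec A H) (E # map Proj [0..<k])) xs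
      (rec_nat (a xs) (\<lambda>n r. h n r xs) (e xs))" if "length xs = k" for xs
  proof (rule evaluates.intros(4)[where ys = "e xs # xs"])
    show "list_all2 (\<lambda>g. evaluates g xs) (E # map Proj [0..<k]) (e xs # xs)"
      using E[OF that] that
      by (simp add: list_all2_map1) (auto simp: list_all2_conv_all_nth intro: evaluates.intros(3))
  qed (rule P[OF that])
  then show ?thesis unfolding recursive_def by blast
qed

lemma recursive_Least:
  assumes "recursive (Suc k) (\<lambda>ys. f (ys ! 0) (drop 1 ys))"
    "\<And>xs. length xs = k \<Longrightarrow> \<exists>n. f n xs = 0"
  shows "recursive k (\<lambda>xs. LEAST n. f n xs = 0)"
proof -
  obtain F where "\<And>ys. length ys = Suc k \<Longrightarrow> evaluates F ys (f (ys ! 0) (drop 1 ys))"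
    using assms(1) unfolding recursive_def by blast
  from this[of "_ # _"] have F: "length xs = k \<Longrightarrow> evaluates F (n # xs) (f n xs)" for n xs
    by simp
  have "evaluates (Mu F) xs (LEAST n. f n xs = 0)" if "length xs = k" for xs
  proof (rule evaluates.intros(7))
    show "evaluates F ((LEAST n. f n xs = 0) # xs) 0"
      using LeastI_ex[OF assms(2)[OF that]] F[OF that] by metis
    show "\<forall>m<LEAST n. f n xs = 0. \<exists>y. evaluates F (m # xs) (Suc y)"
    proof (intro allI impI)
      fix m assume "m < (LEAST n. f n xs = 0)"
      then have "f m xs \<noteq> 0" by (rule not_less_Least)
      then show "\<exists>y. evaluates F (m # xs) (Suc y)" using F[OF that, of m] not0_implies_Suc by metis
    qed
  qed
  then show ?thesis unfolding recursive_def by blast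
qed

lemma recursive_add:
  assumes "recursive k G" "recursive k H" shows "recursive k (\<lambda>xs. G xs + H xs)"
proof (rule recursive_comp2[OF _ assms, of "(+)"])
  have "recursive 2 (\<lambda>xs. rec_nat (xs ! 0) (\<lambda>n r. Suc r) (xs ! 1))"
    by (rule recursive_rec_nat) (auto intro!: recursive_nth recursive_Suc)
  moreover have "rec_nat a (\<lambda>n r. Suc r) b = a + b" for a b
    by (induction b) auto
  ultimately show "recursive 2 (\<lambda>xs. xs ! 0 + xs ! 1)" by simp
qed

lemma recursive_diff:
  assumes "recursive k G" "recursive k H" shows "recursive k (\<lambda>xs. G xs - H xs)"
proof (rule recursive_comp2[OF _ assms, of "(-)"])
  have "recursive 1 (\<lambda>xs. rec_nat 0 (\<lambda>n r. n) (xs ! 0))"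
    by (rule recursive_rec_nat) (auto intro!: recursive_nth recursive_zero)
  moreover have "rec_nat 0 (\<lambda>n r. n) b = b - 1" for b
    by (cases b) auto
  ultimately have pred: "recursive 1 (\<lambda>xs. xs ! 0 - 1)" by simp
  have "recursive 2 (\<lambda>xs. rec_nat (xs ! 0) (\<lambda>n r. r - 1) (xs ! 1))"
    by (intro recursive_rec_nat recursive_comp1[OF pred] recursive_nth) auto
  moreover have "rec_nat a (\<lambda>n r. r - 1) b = a - b" for a b
    by (induction b) auto
  ultimately show "recursive 2 (\<lambda>xs. xs ! 0 - xs ! 1)" by simp
qed

section \<open>The Cantor pairing function and its inverse\<close>

lemma recursive_triangle:
  assumes "recursive k G" shows "recursive k (\<lambda>xs. triangle (G xs))"
proof (rule recursive_comp1[OF _ assms, of triangle])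
  have "recursive 1 (\<lambda>xs. rec_nat 0 (\<lambda>n r. r + Suc n) (xs ! 0))"
    by (intro recursive_rec_nat recursive_zero recursive_add recursive_Suc recursive_nth) auto
  moreover have "rec_nat 0 (\<lambda>n r. r + Suc n) b = triangle b" for b
    by (induction b) auto
  ultimately show "recursive 1 (\<lambda>xs. triangle (xs ! 0))" by simp
qed

lemma recursive_prod_encode:
  "recursive k G \<Longrightarrow> recursive k H \<Longrightarrow> recursive k (\<lambda>xs. prod_encode (G xs, H xs))"
  by (simp add: prod_encode_def recursive_add recursive_triangle)

text \<open>\<open>prod_encode (m, n)\<close> is \<open>triangle (m + n) + m\<close>, so the
  diagonal m + n is the least s with z < triangle (s + 1), and both components follow from it. The
  inequality is written as a truncated difference being 0, the form that
  \<open>recursive_Least\<close> searches for.\<close>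

lemma prod_decode_conv_Least:
  defines "s \<equiv> \<lambda>z. LEAST n. Suc z - triangle (Suc n) = 0"
  shows "prod_decode z = (z - triangle (s z), s z - (z - triangle (s z)))"
proof -
  obtain m n where z: "z = prod_encode (m, n)" by (metis prod_decode_inverse surj_pair)
  have mono: "triangle a \<le> triangle b" if "a \<le> b" for a b
    using that by (induction b rule: dec_induct) auto
  have "s z = m + n"
    unfolding s_def
  proof (rule Least_equality)
    show "Suc z - triangle (Suc (m + n)) = 0" by (simp add: z prod_encode_def)
    fix y assume y: "Suc z - triangle (Suc y) = 0"
    show "m + n \<le> y"
    proof (rule ccontr)
      assume "\<not> m + n \<le> y"
      then have "triangle (Suc y) \<le> triangle (m + n)" by (intro mono) auto
      with y show False by (simp add: z prod_encode_def)
    qed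
  qed
  then show ?thesis by (simp add: z) (simp add: prod_encode_def)
qed

lemma recursive_prod_decode:
  assumes "recursive k G"
  shows "recursive k (\<lambda>xs. fst (prod_decode (G xs)))" "recursive k (\<lambda>xs. snd (prod_decode (G xs)))"
proof -
  have s: "recursive 1 (\<lambda>xs. LEAST n. Suc (xs ! 0) - triangle (Suc n) = 0)"
  proof (rule recursive_Least)
    fix xs :: "nat list"
    have "n \<le> triangle n" for n
      by (induction n) auto
    from this[of "xs ! 0"]
    show "\<exists>n. Suc (xs ! 0) - triangle (Suc n) = 0"
      by (intro exI[of _ "xs ! 0"]) auto
    have "recursive (Suc 1) (\<lambda>ys. Suc (ys ! 1) - triangle (Suc (ys ! 0)))"
      by (intro recursive_diff recursive_Suc recursive_triangle recursive_nth) auto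
    then show "recursive (Suc 1) (\<lambda>ys. Suc (drop 1 ys ! 0) - triangle (Suc (ys ! 0)))"
      by (rule recursive_cong) simp
  qed
  have "recursive 1 (\<lambda>xs. fst (prod_decode (xs ! 0)))" "recursive 1 (\<lambda>xs. snd (prod_decode (xs ! 0)))"
    unfolding prod_decode_conv_Least fst_conv snd_conv
    by (intro recursive_diff recursive_triangle s recursive_nth; simp)+
  then show "recursive k (\<lambda>xs. fst (prod_decode (G xs)))" "recursive k (\<lambda>xs. snd (prod_decode (G xs)))"
    using assms recursive_comp1[of "\<lambda>x. fst (prod_decode x)" k G]
      recursive_comp1[of "\<lambda>x. snd (prod_decode x)" k G] by auto
qed


section \<open>Computable functions between coded types\<close>

text \<open>Codings are bijective, so that every number is a valid argument of a program: primitive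
  recursion along a code also runs on the predecessors of the code.\<close>

class coded =
  fixes enc :: "'a \<Rightarrow> nat"
  assumes bij_enc: "bij enc"
begin

definition dec :: "nat \<Rightarrow> 'a" where
  "dec = inv enc"

lemma dec_enc [simp]: "dec (enc x) = x"
  using bij_enc by (simp add: dec_def bij_def)

lemma enc_dec [simp]: "enc (dec n) = n"
  using bij_enc by (simp add: dec_def bij_def surj_f_inv_f)

end

instantiation nat :: coded
begin
definition enc_nat :: "nat \<Rightarrow> nat" where [simp]: "enc_nat n = n"
instance by standard (auto simp: bij_def inj_def surj_def)
end

lemma dec_nat [simp]: "dec n = (n :: nat)"
  using dec_enc[of n] by (simp only: enc_nat_def)

instantiation prod :: (coded, coded) coded
begin
definition enc_prod :: "'a \<times> 'b \<Rightarrow> nat" where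
  "enc_prod p = prod_encode (enc (fst p), enc (snd p))"
instance
proof
  show "bij (enc :: 'a \<times> 'b \<Rightarrow> nat)"
    by (rule o_bij[where g = "\<lambda>n. (dec (fst (prod_decode n)), dec (snd (prod_decode n)))"])
      (auto simp: enc_prod_def fun_eq_iff)
qed
end

lemma dec_prod: "dec n = (dec (fst (prod_decode n)), dec (snd (prod_decode n)))"
  by (metis (no_types, lifting) dec_enc enc_dec enc_prod_def fst_conv prod.collapse prod_encode_inverse snd_conv)

instantiation list :: (coded) coded
begin
definition enc_list :: "'a list \<Rightarrow> nat" where
  "enc_list xs = list_encode (map enc xs)"
instance
proof
  show "bij (enc :: 'a list \<Rightarrow> nat)"
    by (rule o_bij[where g = "\<lambda>n. map dec (list_decode n)"])
      (auto simp: enc_list_def fun_eq_iff comp_def)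
qed
end

text \<open>Unary on codes: several arguments are packed into tuples, so one set of
  \<open>intro\<close> rules serves all arities.\<close>

definition computable :: "('a :: coded \<Rightarrow> 'b :: coded) \<Rightarrow> bool" where
  "computable f \<longleftrightarrow> recursive 1 (\<lambda>xs. enc (f (dec (xs ! 0))))"

lemma computableI:
  assumes "recursive 1 (\<lambda>xs. F (xs ! 0))" "\<And>n. F n = enc (f (dec n))"
  shows "computable f"
  using assms by (simp add: computable_def)

lemma recursive_computable:
  "computable f \<Longrightarrow> recursive k G \<Longrightarrow> recursive k (\<lambda>xs. enc (f (dec (G xs))))"
  unfolding computable_def by (rule recursive_comp1)

lemma computable_comp: "computable f \<Longrightarrow> computable g \<Longrightarrow> computable (\<lambda>x. f (g x))"
  using recursive_computable[of f 1 "\<lambda>xs. enc (g (dec (xs ! 0)))"] by (simp add: computable_def)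

named_theorems computable_intros

lemma computable_id [computable_intros]: "computable (\<lambda>x. x)"
  unfolding computable_def by (simp add: recursive_nth)

lemma computable_const [computable_intros]: "computable (\<lambda>x. c)"
  unfolding computable_def by (simp add: recursive_const)

lemma computable_Pair [computable_intros]:
  "computable f \<Longrightarrow> computable g \<Longrightarrow> computable (\<lambda>x. (f x, g x))"
  unfolding computable_def enc_prod_def fst_conv snd_conv by (rule recursive_prod_encode)

lemma computable_fst' : "computable fst"
  unfolding computable_def dec_prod fst_conv enc_dec
  by (intro recursive_prod_decode recursive_nth) simp

lemma computable_snd' : "computable snd"
  unfolding computable_def dec_prod snd_conv enc_dec
  by (intro recursive_prod_decode recursive_nth) simp

lemmas computable_fst [computable_intros] = computable_comp[OF computable_fst']
lemmas computable_snd [computable_intros] = computable_comp[OF computable_snd']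

lemma computable_comp2:
  "computable (\<lambda>p. f (fst p) (snd p)) \<Longrightarrow> computable g \<Longrightarrow> computable h \<Longrightarrow>
    computable (\<lambda>x. f (g x) (h x))"
  using computable_comp[of "\<lambda>p. f (fst p) (snd p)" "\<lambda>x. (g x, h x)"] by (simp add: computable_Pair)

lemma computable_comp3:
  "computable (\<lambda>p. f (fst p) (fst (snd p)) (snd (snd p))) \<Longrightarrow> computable g \<Longrightarrow> computable h \<Longrightarrow>
    computable k \<Longrightarrow> computable (\<lambda>x. f (g x) (h x) (k x))"
  using computable_comp[of "\<lambda>p. f (fst p) (fst (snd p)) (snd (snd p))" "\<lambda>x. (g x, h x, k x)"]
  by (simp add: computable_Pair)

lemma computable_enc: "computable f \<Longrightarrow> computable (\<lambda>x. enc (f x))"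
  by (simp add: computable_def)

lemma computable_dec: "computable f \<Longrightarrow> computable (\<lambda>x. dec (f x))"
  by (simp add: computable_def)

text \<open>The recursion runs on codes, its step function receiving the parameter, the counter and
  the previous value as a coded triple; decoding what was encoded makes it agree with the recursion
  on values.\<close>

lemma computable_rec_nat [computable_intros]:
  assumes "computable a" "computable (\<lambda>p. h (fst p) (fst (snd p)) (snd (snd p)))" "computable e"
  shows "computable (\<lambda>x. rec_nat (a x) (h x) (e x))"
proof (rule computableI)
  let ?H = "\<lambda>n r m. enc (h (dec m) n (dec r))"
  have "recursive (Suc (Suc 1)) (\<lambda>ys. enc ((\<lambda>p. h (fst p) (fst (snd p)) (snd (snd p)))
      (dec (prod_encode (ys ! 2, prod_encode (ys ! 0, ys ! 1))))))"
    by (rule recursive_computable[OF assms(2)]) (auto intro!: recursive_prod_encode recursive_nth)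
  then have "recursive (Suc (Suc 1)) (\<lambda>ys. ?H (ys ! 0) (ys ! 1) (drop 2 ys ! 0))"
    by (rule recursive_cong) (simp add: dec_prod)
  then show "recursive 1 (\<lambda>xs. (\<lambda>z. rec_nat (enc (a (dec z))) (\<lambda>n r. ?H n r z) (enc (e (dec z)))) (xs ! 0))"
    using assms(1,3) unfolding computable_def
    by (intro recursive_rec_nat[where h = "\<lambda>n r xs. ?H n r (xs ! 0)"])
  fix n
  have "rec_nat (enc b) (\<lambda>m r. ?H m r n) j = enc (rec_nat b (h (dec n)) j)" for b j
    by (induction j) auto
  then show "rec_nat (enc (a (dec n))) (\<lambda>m r. ?H m r n) (enc (e (dec n)))
      = enc (rec_nat (a (dec n)) (h (dec n)) (e (dec n)))"
    by simp
qed

lemma computable_if_pos: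
  assumes "computable b" "computable f" "computable g"
  shows "computable (\<lambda>x. if b x > (0::nat) then f x else g x)"
proof -
  have "computable (\<lambda>x. rec_nat (g x) (\<lambda>_ _. f x) (b x))"
    by (intro computable_intros assms computable_comp[OF assms(2)])
  moreover have "rec_nat (g x) (\<lambda>_ _. f x) (b x) = (if b x > 0 then f x else g x)" for x
    by (cases "b x") auto
  ultimately show ?thesis by simp
qed

lemma computable_Suc [computable_intros]: "computable f \<Longrightarrow> computable (\<lambda>x. Suc (f x))"
  unfolding computable_def enc_nat_def by (rule recursive_Suc)

lemma computable_add [computable_intros]:
  "computable f \<Longrightarrow> computable g \<Longrightarrow> computable (\<lambda>x. f x + g x :: nat)"
  unfolding computable_def enc_nat_def by (rule recursive_add)

lemma computable_diff [computable_intros]: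
  "computable f \<Longrightarrow> computable g \<Longrightarrow> computable (\<lambda>x. f x - g x :: nat)"
  unfolding computable_def enc_nat_def by (rule recursive_diff)

lemma computable_mult [computable_intros]:
  assumes "computable f" "computable g" shows "computable (\<lambda>x. f x * g x :: nat)"
proof -
  have "computable (\<lambda>x. rec_nat 0 (\<lambda>_ r. r + f x) (g x))"
    by (intro computable_intros assms computable_comp[OF assms(1)])
  moreover have "rec_nat 0 (\<lambda>_ r. r + a) b = a * b" for a b :: nat
    by (induction b) auto
  ultimately show ?thesis by simp
qed

lemma computable_power [computable_intros]:
  assumes "computable f" "computable g" shows "computable (\<lambda>x. f x ^ g x :: nat)"
proof -
  have "computable (\<lambda>x. rec_nat 1 (\<lambda>_ r. r * f x) (g x))"
    by (intro computable_intros assms computable_comp[OF assms(1)])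
  moreover have "rec_nat 1 (\<lambda>_ r. r * a) b = a ^ b" for a b :: nat
    by (induction b) auto
  ultimately show ?thesis by simp
qed

lemma computable_max [computable_intros]:
  assumes "computable f" "computable g" shows "computable (\<lambda>x. max (f x) (g x) :: nat)"
proof -
  have "computable (\<lambda>x. f x + (g x - f x))" by (intro computable_intros assms)
  moreover have "a + (b - a) = max a b" for a b :: nat by auto
  ultimately show ?thesis by (simp only:)
qed

section \<open>Decidable predicates, bounded quantifiers and search\<close>

definition decidable :: "('a :: coded \<Rightarrow> bool) \<Rightarrow> bool" where
  "decidable P \<longleftrightarrow> computable (\<lambda>x. of_bool (P x) :: nat)"

lemma computable_of_bool [computable_intros]:
  "decidable P \<Longrightarrow> computable (\<lambda>x. of_bool (P x) :: nat)"
  by (simp add: decidable_def)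

lemma computable_if [computable_intros]:
  assumes "decidable P" "computable f" "computable g"
  shows "computable (\<lambda>x. if P x then f x else g x)"
  using computable_if_pos[OF assms(1)[unfolded decidable_def] assms(2,3)] by simp

lemma decidable_less [computable_intros]:
  assumes "computable f" "computable g" shows "decidable (\<lambda>x. f x < (g x :: nat))"
proof -
  have "computable (\<lambda>x. if g x - f x > 0 then 1 else 0 :: nat)"
    by (intro computable_if_pos computable_intros assms)
  then show ?thesis by (simp add: decidable_def of_bool_def)
qed

lemma decidable_not [computable_intros]:
  assumes "decidable P" shows "decidable (\<lambda>x. \<not> P x)"
proof -
  have "computable (\<lambda>x. 1 - of_bool (P x) :: nat)"
    using assms unfolding decidable_def by (intro computable_diff computable_const)
  moreover have "(\<lambda>x. 1 - of_bool (P x) :: nat) = (\<lambda>x. of_bool (\<not> P x))" by auto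
  ultimately show ?thesis by (simp add: decidable_def)
qed

lemma decidable_conj [computable_intros]:
  assumes "decidable P" "decidable Q" shows "decidable (\<lambda>x. P x \<and> Q x)"
  using computable_mult[OF assms[unfolded decidable_def]]
  by (simp add: decidable_def of_bool_conj)

lemma decidable_disj [computable_intros]:
  assumes "decidable P" "decidable Q" shows "decidable (\<lambda>x. P x \<or> Q x)"
  using decidable_not[OF decidable_conj[OF assms[THEN decidable_not]]] by simp

lemma decidable_imp [computable_intros]:
  assumes "decidable P" "decidable Q" shows "decidable (\<lambda>x. P x \<longrightarrow> Q x)"
  unfolding imp_conv_disj by (intro decidable_disj decidable_not assms)

lemma decidable_le [computable_intros]:
  assumes "computable f" "computable g" shows "decidable (\<lambda>x. f x \<le> (g x :: nat))"
  using decidable_not[OF decidable_less[OF assms(2,1)]] by (simp add: not_less)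

lemma decidable_eq [computable_intros]:
  assumes "computable f" "computable g" shows "decidable (\<lambda>x. f x = (g x :: nat))"
  using decidable_conj[OF decidable_le[OF assms] decidable_le[OF assms(2,1)]] by (simp add: eq_iff)

lemma decidable_comp: "decidable P \<Longrightarrow> computable f \<Longrightarrow> decidable (\<lambda>x. P (f x))"
  unfolding decidable_def by (rule computable_comp)

lemma decidable_ex_less [computable_intros]:
  fixes P :: "'a :: coded \<Rightarrow> nat \<Rightarrow> bool"
  assumes "decidable (\<lambda>p. P (fst p) (snd p))" "computable e"
  shows "decidable (\<lambda>x. \<exists>i<e x. P x i)"
proof -
  have "computable (\<lambda>x. rec_nat 0 (\<lambda>i r. if P x i then 1 else r) (e x) :: nat)"
    by (intro computable_intros assms decidable_comp[OF assms(1), of "\<lambda>p. (fst p, fst (snd p))", simplified])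
  moreover have "rec_nat 0 (\<lambda>i r. if P x i then 1 else r) n = (of_bool (\<exists>i<n. P x i) :: nat)" for x n
    by (induction n) (auto simp: less_Suc_eq)
  ultimately show ?thesis by (simp add: decidable_def)
qed

lemma decidable_all_less [computable_intros]:
  fixes P :: "'a :: coded \<Rightarrow> nat \<Rightarrow> bool"
  assumes "decidable (\<lambda>p. P (fst p) (snd p))" "computable e"
  shows "decidable (\<lambda>x. \<forall>i<e x. P x i)"
proof -
  have "decidable (\<lambda>x. \<not> (\<exists>i<e x. \<not> P x i))"
    by (intro computable_intros assms)
  then show ?thesis by simp
qed

lemma diff_of_bool_eq_0: "(1 - of_bool P = (0 :: nat)) = P"
  by simp

lemma computable_Least [computable_intros]:
  fixes P :: "'a :: coded \<Rightarrow> nat \<Rightarrow> bool"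
  assumes "decidable (\<lambda>p. P (fst p) (snd p))" "\<And>x. \<exists>n. P x n"
  shows "computable (\<lambda>x. LEAST n. P x n)"
proof (rule computableI)
  let ?f = "\<lambda>n z. 1 - (of_bool (P (dec z) n) :: nat)"
  have "computable (\<lambda>p. 1 - (of_bool (P (fst p) (snd p)) :: nat))"
    by (intro computable_intros assms)
  from recursive_computable[OF this, of 2 "\<lambda>ys. prod_encode (ys ! 1, ys ! 0)"]
  have "recursive 2 (\<lambda>ys. ?f (ys ! 0) (ys ! 1))"
    by (simp add: dec_prod recursive_prod_encode recursive_nth)
  then have "recursive (Suc 1) (\<lambda>ys. ?f (ys ! 0) (drop 1 ys ! 0))"
    unfolding Suc_1 by (rule recursive_cong) simp
  moreover have "\<exists>n. ?f n (xs ! 0) = 0" for xs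
    using assms(2)[of "dec (xs ! 0)"] by auto
  ultimately have "recursive 1 (\<lambda>xs. LEAST n. ?f n (xs ! 0) = 0)"
    by (intro recursive_Least)
  then show "recursive 1 (\<lambda>xs. (\<lambda>z. LEAST n. P (dec z) n) (xs ! 0))"
    by (simp only: diff_of_bool_eq_0)
qed simp

lemma computable_case_nat [computable_intros]:
  assumes "computable a" "computable (\<lambda>p. f (fst p) (snd p))" "computable e"
  shows "computable (\<lambda>x. case e x of 0 \<Rightarrow> a x | Suc m \<Rightarrow> f x m)"
proof -
  have "computable (\<lambda>x. rec_nat (a x) (\<lambda>m r. f x m) (e x))"
    by (intro computable_intros assms computable_comp2[OF assms(2), of "\<lambda>p. fst p" "\<lambda>p. fst (snd p)"])
  moreover have "rec_nat (a x) (\<lambda>m r. f x m) n = (case n of 0 \<Rightarrow> a x | Suc m \<Rightarrow> f x m)" for x n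
    by (cases n) auto
  ultimately show ?thesis by simp
qed

section \<open>Lists and their codes\<close>

lemma computable_Cons [computable_intros]:
  assumes "computable f" "computable g" shows "computable (\<lambda>x. f x # g x)"
proof -
  have "recursive 1 (\<lambda>xs. Suc (prod_encode (enc (f (dec (xs ! 0))), enc (g (dec (xs ! 0))))))"
    using assms unfolding computable_def by (intro recursive_Suc recursive_prod_encode)
  then show ?thesis by (simp add: computable_def enc_list_def)
qed

lemma dec_0_list: "dec 0 = []"
  by (metis dec_enc enc_list_def list.simps(8) list_encode.simps(1))

lemma dec_Suc_list: "dec (Suc n) = dec (fst (prod_decode n)) # dec (snd (prod_decode n))"
proof -
  have "enc (dec (fst (prod_decode n)) # dec (snd (prod_decode n)) :: 'a list) = Suc n"
    by (simp add: enc_list_def del: enc_dec) (metis enc_dec enc_list_def prod.collapse prod_decode_inverse)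
  then show ?thesis by (metis dec_enc)
qed

text \<open>The empty list has code 0, and the predecessor of any other code is the code of the pair
  of head and tail, so a case distinction on lists is one on numbers.\<close>

lemma case_list_conv_case_enc:
  "(case l of [] \<Rightarrow> a | y # ys \<Rightarrow> f y ys)
    = (case enc l of 0 \<Rightarrow> a | Suc m \<Rightarrow> f (fst (dec m)) (snd (dec m)))"
proof -
  have "(case dec n of [] \<Rightarrow> a | y # ys \<Rightarrow> f y ys)
      = (case n of 0 \<Rightarrow> a | Suc m \<Rightarrow> f (fst (dec m)) (snd (dec m)))" for n
    by (cases n) (auto simp: dec_0_list dec_Suc_list dec_prod)
  from this[of "enc l"] show ?thesis by simp
qed

lemma computable_case_list [computable_intros]:
  assumes "computable a" "computable (\<lambda>p. f (fst p) (fst (snd p)) (snd (snd p)))" "computable e"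
  shows "computable (\<lambda>x. case e x of [] \<Rightarrow> a x | y # ys \<Rightarrow> f x y ys)"
  by (subst case_list_conv_case_enc)
    (intro computable_intros computable_enc computable_dec computable_comp3[OF assms(2)] assms)

text \<open>The index is a constant, so the induction on it takes place outside the computed
  function. The shifted result, with 0 out of range, is what \<open>run\<close> returns for
  \<open>Proj i\<close>.\<close>

lemma computable_nth: "computable (\<lambda>xs. if i < length xs then Suc (xs ! i) else 0)"
proof (induction i)
  case 0
  have "computable (\<lambda>xs. case xs of [] \<Rightarrow> 0 | y # ys \<Rightarrow> Suc y)"
    by (intro computable_intros)
  moreover have "(case xs of [] \<Rightarrow> 0 | y # ys \<Rightarrow> Suc y) = (if 0 < length xs then Suc (xs ! 0) else 0)" for xs
    by (cases xs) auto
  ultimately show ?case by simp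
next
  case (Suc i)
  have "computable (\<lambda>xs. case xs of [] \<Rightarrow> 0 | y # ys \<Rightarrow> if i < length ys then Suc (ys ! i) else 0)"
    by (intro computable_case_list computable_const computable_comp[OF Suc] computable_snd computable_id)
  moreover have "(case xs of [] \<Rightarrow> 0 | y # ys \<Rightarrow> if i < length ys then Suc (ys ! i) else 0)
      = (if Suc i < length xs then Suc (xs ! Suc i) else 0)" for xs :: "nat list"
    by (cases xs) auto
  ultimately show ?case by simp
qed

section \<open>Bounded evaluation\<close>

text \<open>The value \<open>0\<close> stands for an unfinished evaluation and \<open>Suc y\<close> for the result \<open>y\<close>.\<close>

fun run :: "recf \<Rightarrow> nat \<Rightarrow> nat list \<Rightarrow> nat" where
  "run Zero s xs = 1"
| "run Succ s xs = (case xs of [] \<Rightarrow> 0 | x # ys \<Rightarrow> case ys of [] \<Rightarrow> Suc (Suc x) | _ # _ \<Rightarrow> 0)"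
| "run (Proj i) s xs = (if i < length xs then Suc (xs ! i) else 0)"
| "run (Comp f gs) s xs =
    (if \<exists>g\<in>set gs. run g s xs = 0 then 0 else run f s (map (\<lambda>g. run g s xs - 1) gs))"
| "run (PrimRec f g) s xs = (case xs of [] \<Rightarrow> 0 | n # ys \<Rightarrow>
    rec_nat (run f s ys) (\<lambda>m r. if r = 0 then 0 else run g s (m # (r - 1) # ys)) n)"
| "run (Mu f) s xs = rec_nat 0
    (\<lambda>n r. if run f s (n # xs) = 1 \<and> (\<forall>m<n. 1 < run f s (m # xs)) then Suc n else r) s"

text \<open>The stage bounds only the search of \<open>Mu\<close>; all other clauses terminate by
  recursion. The program is fixed, and the function is computable in stage and arguments together,
  which is what enumerating a single machine by stages requires.\<close>

lemma computable_run: "computable (\<lambda>p. run f (fst p) (snd p))"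
proof (induction f)
  case Zero
  then show ?case by (simp add: computable_const)
next
  case Succ
  show ?case unfolding run.simps by (intro computable_intros)
next
  case (Proj i)
  show ?case unfolding run.simps by (intro computable_comp[OF computable_nth] computable_snd computable_id)
next
  case (Comp f gs)
  have "decidable (\<lambda>p. \<exists>g\<in>set gs. run g (fst p) (snd p) = 0)"
    using Comp(2)
  proof (induction gs)
    case Nil
    show ?case by (simp add: decidable_def computable_const)
  next
    case (Cons g gs)
    have "decidable (\<lambda>p. run g (fst p) (snd p) = 0 \<or> (\<exists>g\<in>set gs. run g (fst p) (snd p) = 0))"
      using Cons by (intro computable_intros) auto
    then show ?case by simp
  qed
  moreover have "computable (\<lambda>p. map (\<lambda>g. run g (fst p) (snd p) - 1) gs)"
    using Comp(2)
  proof (induction gs)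
    case Nil
    show ?case by (simp add: computable_const)
  next
    case (Cons g gs)
    have "computable (\<lambda>p. (run g (fst p) (snd p) - 1) # map (\<lambda>g. run g (fst p) (snd p) - 1) gs)"
      using Cons by (intro computable_intros) auto
    then show ?case by simp
  qed
  ultimately show ?case
    unfolding run.simps by (intro computable_intros computable_comp2[OF Comp(1)])
next
  case (PrimRec f g)
  show ?case
    unfolding run.simps
    by (intro computable_intros computable_comp2[OF PrimRec(1)] computable_comp2[OF PrimRec(2)])
next
  case (Mu f)
  show ?case
    unfolding run.simps by (intro computable_intros computable_comp2[OF Mu])
qed

text \<open>The recursion returns the last hit below s, which is the only one by assumption.\<close>

lemma rec_nat_search_iff:
  assumes "\<And>m n. P m \<Longrightarrow> P n \<Longrightarrow> m = n"
  shows "rec_nat 0 (\<lambda>n r. if P n then Suc n else r) s = Suc y \<longleftrightarrow> y < s \<and> P y"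
  by (induction s) (use assms in \<open>auto simp: less_Suc_eq\<close>)

lemma run_Mu_iff:
  "run (Mu f) s xs = Suc y \<longleftrightarrow>
    y < s \<and> run f s (y # xs) = 1 \<and> (\<forall>m<y. 1 < run f s (m # xs))"
  unfolding run.simps
proof (subst rec_nat_search_iff)
  fix m n
  assume "run f s (m # xs) = 1 \<and> (\<forall>l<m. 1 < run f s (l # xs))"
    "run f s (n # xs) = 1 \<and> (\<forall>l<n. 1 < run f s (l # xs))"
  then show "m = n" by (metis less_irrefl nat_neq_iff)
qed blast

lemma run_sound: "run f s xs = Suc y \<Longrightarrow> evaluates f xs y"
proof (induction f arbitrary: xs y)
  case Zero
  then show ?case by (auto intro: evaluates.intros)
next
  case Succ
  then show ?case by (auto intro: evaluates.intros split: list.splits)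
next
  case (Proj i)
  then show ?case by (auto intro: evaluates.intros split: if_splits)
next
  case (Comp f gs)
  have nz: "\<And>g. g \<in> set gs \<Longrightarrow> run g s xs \<noteq> 0" and f: "run f s (map (\<lambda>g. run g s xs - 1) gs) = Suc y"
    using Comp.prems by (auto split: if_splits)
  show ?case
  proof (rule evaluates.intros(4))
    show "list_all2 (\<lambda>g. evaluates g xs) gs (map (\<lambda>g. run g s xs - 1) gs)"
      using Comp.IH(2) nz by (auto simp: list_all2_conv_all_nth)
  qed (rule Comp.IH(1)[OF f])
next
  case (PrimRec f g)
  then obtain n ys where xs: "xs = n # ys" by (auto split: list.splits)
  let ?r = "rec_nat (run f s ys) (\<lambda>m r. if r = 0 then 0 else run g s (m # (r - 1) # ys))"
  have "?r n = Suc y \<Longrightarrow> evaluates (PrimRec f g) (n # ys) y"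
  proof (induction n arbitrary: y)
    case 0
    then show ?case using PrimRec.IH(1) by (auto intro: evaluates.intros)
  next
    case (Suc n)
    then obtain r where r: "?r n = Suc r" by (cases "?r n") auto
    with Suc.prems have "run g s (n # r # ys) = Suc y" by simp
    with Suc.IH[OF r] show ?case using PrimRec.IH(2) by (blast intro: evaluates.intros)
  qed
  then show ?case using PrimRec.prems xs by simp
next
  case (Mu f)
  have "\<exists>z. evaluates f (m # xs) (Suc z)" if "m < y" for m
  proof -
    have "1 < run f s (m # xs)" using Mu.prems that by (simp only: run_Mu_iff)
    then have "run f s (m # xs) = Suc (Suc (run f s (m # xs) - 2))" by simp
    with Mu.IH show ?thesis by blast
  qed
  moreover have "evaluates f (y # xs) 0"
    using Mu by (simp only: run_Mu_iff)
  ultimately show ?case by (auto intro: evaluates.intros)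
qed

text \<open>A larger stage merely lengthens the searches of \<open>Mu\<close>, and by
  \<open>run_Mu_iff\<close> a hit survives since later candidates cannot satisfy the search
  condition as well.\<close>

lemma run_mono: "run f s xs = Suc y \<Longrightarrow> s \<le> s' \<Longrightarrow> run f s' xs = Suc y"
proof (induction f arbitrary: xs y)
  case (Comp f gs)
  have nz: "\<And>g. g \<in> set gs \<Longrightarrow> run g s xs \<noteq> 0" and f: "run f s (map (\<lambda>g. run g s xs - 1) gs) = Suc y"
    using Comp.prems by (auto split: if_splits)
  have "run g s' xs = run g s xs" if "g \<in> set gs" for g
    using Comp.IH(2)[OF that _ Comp.prems(2)] nz[OF that] by (metis not0_implies_Suc)
  then have "map (\<lambda>g. run g s' xs - 1) gs = map (\<lambda>g. run g s xs - 1) gs"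
    "\<not> (\<exists>g\<in>set gs. run g s' xs = 0)"
    using nz by auto
  then show ?case using Comp.IH(1)[OF f Comp.prems(2)] by (simp only: run.simps if_False)
next
  case (PrimRec f g)
  then obtain n ys where xs: "xs = n # ys" by (auto split: list.splits)
  let ?r = "\<lambda>s. rec_nat (run f s ys) (\<lambda>m r. if r = 0 then 0 else run g s (m # (r - 1) # ys))"
  have "?r s n = Suc y \<Longrightarrow> ?r s' n = Suc y"
  proof (induction n arbitrary: y)
    case 0
    then show ?case using PrimRec by simp
  next
    case (Suc n)
    then obtain r where r: "?r s n = Suc r" by (cases "?r s n") auto
    with Suc.prems have "run g s (n # r # ys) = Suc y" by simp
    with Suc.IH[OF r] show ?case using PrimRec by simp
  qed
  then show ?case using PrimRec.prems xs by simp
next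
  case (Mu f)
  have "1 < run f s' (m # xs)" if "m < y" for m
  proof -
    have "1 < run f s (m # xs)" using Mu.prems that by (simp only: run_Mu_iff)
    then have "run f s (m # xs) = Suc (Suc (run f s (m # xs) - 2))" by simp
    with Mu.IH Mu.prems(2) show ?thesis by (metis Suc_less_eq zero_less_Suc One_nat_def)
  qed
  moreover have "y < s'" "run f s' (y # xs) = 1"
    using Mu.IH[of "y # xs" 0] Mu.prems unfolding run_Mu_iff by auto
  ultimately show ?case unfolding run_Mu_iff by blast
qed auto

lemma run_complete: "evaluates f xs y \<Longrightarrow> \<exists>s. run f s xs = Suc y"
proof (induction rule: evaluates.induct)
  case (4 xs gs ys f z)
  have "\<exists>s. list_all2 (\<lambda>g y. run g s xs = Suc y) gs ys"
    using 4(1)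
  proof (induction rule: list_all2_induct)
    case (Cons g gs y ys)
    then obtain s s' where "list_all2 (\<lambda>g y. run g s xs = Suc y) gs ys" "run g s' xs = Suc y"
      by blast
    then have "list_all2 (\<lambda>g y. run g (max s s') xs = Suc y) (g # gs) (y # ys)"
      by (auto intro: run_mono elim!: list_all2_mono)
    then show ?case by blast
  qed auto
  then obtain s where s: "list_all2 (\<lambda>g y. run g s xs = Suc y) gs ys" ..
  from 4 obtain s' where s': "run f s' ys = Suc z" by blast
  let ?s = "max s s'"
  have gs: "list_all2 (\<lambda>g y. run g ?s xs = Suc y) gs ys"
    using s by (auto intro: run_mono elim!: list_all2_mono)
  then have "map (\<lambda>g. run g ?s xs - 1) gs = ys"
    by (auto simp: list_all2_conv_all_nth intro!: nth_equalityI)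
  moreover have "\<not> (\<exists>g\<in>set gs. run g ?s xs = 0)"
    using gs by (auto simp: list_all2_conv_all_nth in_set_conv_nth)
  ultimately have "run (Comp f gs) ?s xs = Suc z"
    using run_mono[OF s', of ?s] by simp
  then show ?case ..
next
  case (6 f g n xs r y)
  then obtain s s' where s: "run (PrimRec f g) s (n # xs) = Suc r" "run g s' (n # r # xs) = Suc y"
    by blast
  from run_mono[OF s(1), of "max s s'"] run_mono[OF s(2), of "max s s'"]
  have "run (PrimRec f g) (max s s') (Suc n # xs) = Suc y" by simp
  then show ?case ..
next
  case (7 f n xs)
  then obtain s where s: "run f s (n # xs) = Suc 0" by blast
  have "\<exists>s. \<forall>m<k. 1 < run f s (m # xs)" if "k \<le> n" for k
    using that
  proof (induction k)
    case (Suc k)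
    then obtain s where s: "\<forall>m<k. 1 < run f s (m # xs)" by auto
    from Suc.prems 7 obtain s' y where s': "run f s' (k # xs) = Suc (Suc y)"
      by (meson Suc_le_lessD)
    have "1 < run f (max s s') (m # xs)" if m: "m < Suc k" for m
    proof (cases "m = k")
      case True
      then show ?thesis using run_mono[OF s', of "max s s'"] by simp
    next
      case False
      with m s have l: "1 < run f s (m # xs)" by simp
      then have "run f s (m # xs) = Suc (run f s (m # xs) - 1)" by simp
      from run_mono[OF this, of "max s s'"] l show ?thesis by simp
    qed
    then show ?case by blast
  qed auto
  then obtain s' where s': "\<forall>m<n. 1 < run f s' (m # xs)" by blast
  \<comment> \<open>\<open>Suc n\<close> is included because a search at stage s tries only
    candidates below s.\<close>
  let ?s = "max (Suc n) (max s s')"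
  have "1 < run f ?s (m # xs)" if "m < n" for m
  proof -
    have l: "1 < run f s' (m # xs)" using s' that by simp
    then have "run f s' (m # xs) = Suc (run f s' (m # xs) - 1)" by simp
    from run_mono[OF this, of ?s] l show ?thesis by simp
  qed
  then have "run (Mu f) ?s xs = Suc n"
    using run_mono[OF s, of ?s] unfolding run_Mu_iff by auto
  then show ?case ..
qed auto

section \<open>Dyadic rationals\<close>

text \<open>A computable numerator and exponent make comparisons of reals decidable. Numerators are
  natural numbers, so subtraction is avoided; this is why \<open>keeps\<close> has sums on both
  sides.\<close>

definition dyadic :: "('a :: coded \<Rightarrow> real) \<Rightarrow> bool" where
  "dyadic f \<longleftrightarrow> (\<exists>a e. computable a \<and> computable e \<and> (\<forall>x. f x = real (a x :: nat) / 2 ^ (e x :: nat)))"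

lemma dyadicI: "computable a \<Longrightarrow> computable e \<Longrightarrow> (\<And>x. f x = real (a x) / 2 ^ e x) \<Longrightarrow> dyadic f"
  unfolding dyadic_def by blast

lemma dyadic_zero [computable_intros]: "dyadic (\<lambda>x. 0)"
  by (rule dyadicI[of "\<lambda>x. 0" "\<lambda>x. 0"]) (auto intro: computable_intros)

lemma dyadic_inverse_power [computable_intros]: "computable e \<Longrightarrow> dyadic (\<lambda>x. 1 / 2 ^ e x)"
  by (rule dyadicI[of "\<lambda>x. 1" e]) (auto intro: computable_intros)

lemma dyadic_comp: "dyadic f \<Longrightarrow> computable g \<Longrightarrow> dyadic (\<lambda>x. f (g x))"
  unfolding dyadic_def by (metis computable_comp)

lemma dyadic_comp2:
  "dyadic (\<lambda>p. f (fst p) (snd p)) \<Longrightarrow> computable g \<Longrightarrow> computable k \<Longrightarrow> dyadic (\<lambda>x. f (g x) (k x))"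
  using dyadic_comp[of "\<lambda>p. f (fst p) (snd p)" "\<lambda>x. (g x, k x)"] by (simp add: computable_Pair)

lemma dyadic_add [computable_intros]:
  assumes "dyadic f" "dyadic g" shows "dyadic (\<lambda>x. f x + g x)"
proof -
  obtain a e where f: "computable a" "computable e" "\<And>x. f x = real (a x) / 2 ^ e x"
    using assms(1) unfolding dyadic_def by blast
  obtain b d where g: "computable b" "computable d" "\<And>x. g x = real (b x) / 2 ^ d x"
    using assms(2) unfolding dyadic_def by blast
  show ?thesis
  proof (rule dyadicI)
    show "computable (\<lambda>x. a x * 2 ^ d x + b x * 2 ^ e x)" "computable (\<lambda>x. e x + d x)"
      by (intro computable_intros f g)+
    show "f x + g x = real (a x * 2 ^ d x + b x * 2 ^ e x) / 2 ^ (e x + d x)" for x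
      by (simp add: f g field_simps power_add)
  qed
qed

lemma dyadic_mult [computable_intros]:
  assumes "dyadic f" "dyadic g" shows "dyadic (\<lambda>x. f x * g x)"
proof -
  obtain a e where f: "computable a" "computable e" "\<And>x. f x = real (a x) / 2 ^ e x"
    using assms(1) unfolding dyadic_def by blast
  obtain b d where g: "computable b" "computable d" "\<And>x. g x = real (b x) / 2 ^ d x"
    using assms(2) unfolding dyadic_def by blast
  show ?thesis
    by (rule dyadicI[of "\<lambda>x. a x * b x" "\<lambda>x. e x + d x"])
      (auto intro!: computable_intros f g simp: f(3) g(3) power_add)
qed

lemma dyadic_if [computable_intros]:
  assumes "decidable P" "dyadic f" "dyadic g" shows "dyadic (\<lambda>x. if P x then f x else g x)"
proof -
  obtain a e where f: "computable a" "computable e" "\<And>x. f x = real (a x) / 2 ^ e x"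
    using assms(2) unfolding dyadic_def by blast
  obtain b d where g: "computable b" "computable d" "\<And>x. g x = real (b x) / 2 ^ d x"
    using assms(3) unfolding dyadic_def by blast
  show ?thesis
    by (rule dyadicI[of "\<lambda>x. if P x then a x else b x" "\<lambda>x. if P x then e x else d x"])
      (auto intro!: computable_if assms f g simp: f(3) g(3))
qed

lemma dyadic_sum [computable_intros]:
  fixes f :: "'a :: coded \<Rightarrow> nat \<Rightarrow> real"
  assumes "dyadic (\<lambda>p. f (fst p) (snd p))" "computable e"
  shows "dyadic (\<lambda>x. \<Sum>n<e x. f x n)"
proof -
  obtain a d where f: "computable a" "computable d" "\<And>x. f (fst x) (snd x) = real (a x) / 2 ^ d x"
    using assms(1) unfolding dyadic_def by blast
  \<comment> \<open>Adds two fractions over the product of their denominators, without reducing the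
    result.\<close>
  define step where "step x n q =
    (fst q * 2 ^ d (x, n) + a (x, n) * 2 ^ snd q, snd q + d (x, n))" for x n and q :: "nat \<times> nat"
  have "computable (\<lambda>x. rec_nat (0, 0) (step x) (e x))"
    unfolding step_def by (intro computable_intros assms computable_comp[OF f(1)] computable_comp[OF f(2)])
  note c = this
  have "(\<Sum>n<m. f x n)
      = real (fst (rec_nat (0, 0) (step x) m)) / 2 ^ snd (rec_nat (0, 0) (step x) m)" for x m
  proof (induction m)
    case (Suc m)
    then show ?case using f(3)[of "(x, m)"] by (simp add: step_def field_simps power_add)
  qed simp
  then show ?thesis
    by (intro dyadicI[OF computable_fst[OF c] computable_snd[OF c]])
qed

lemma decidable_dyadic_le [computable_intros]:
  assumes "dyadic f" "dyadic g" shows "decidable (\<lambda>x. f x \<le> g x)"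
proof -
  obtain a e where f: "computable a" "computable e" "\<And>x. f x = real (a x) / 2 ^ e x"
    using assms(1) unfolding dyadic_def by blast
  obtain b d where g: "computable b" "computable d" "\<And>x. g x = real (b x) / 2 ^ d x"
    using assms(2) unfolding dyadic_def by blast
  have "decidable (\<lambda>x. a x * 2 ^ d x \<le> b x * 2 ^ e x)"
    by (intro computable_intros f g)
  moreover have "f x \<le> g x \<longleftrightarrow> a x * 2 ^ d x \<le> b x * 2 ^ e x" for x
  proof -
    have "f x \<le> g x \<longleftrightarrow> real (a x * 2 ^ d x) \<le> real (b x * 2 ^ e x)"
      by (simp add: f g field_simps)
    then show ?thesis by (simp only: of_nat_le_iff)
  qed
  ultimately show ?thesis by simp
qed


section \<open>Codes of strings\<close>

lemma str_code_nat_str [simp]: "str_code (nat_str x) = x"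
  using bij_str_code by (simp add: nat_str_def bij_def surj_f_inv_f)

lemma nat_str_str_code [simp]: "nat_str (str_code s) = s"
  using bij_str_code by (simp add: nat_str_def bij_def)

text \<open>\<open>Suc (str_code s)\<close> is the number with binary expansion 1 followed by s;
  appending q shifts it by the length of q and adds the number w that q denotes.\<close>

lemma str_code_append: "\<exists>w < 2 ^ length q. Suc (str_code (p @ q)) = Suc (str_code p) * 2 ^ length q + w"
proof (induction q rule: rev_induct)
  case (snoc b q)
  then obtain w where w: "w < 2 ^ length q" "Suc (str_code (p @ q)) = Suc (str_code p) * 2 ^ length q + w"
    by blast
  have "Suc (str_code (p @ q @ [b])) = 2 * Suc (str_code (p @ q)) + of_bool b"
    unfolding append_assoc[symmetric] by (simp only: str_code_snoc) simp
  with w show ?case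
    by (intro exI[of _ "2 * w + of_bool b"]) (auto simp: algebra_simps)
qed auto

lemma length_nat_str_eqI:
  assumes "2 ^ l \<le> Suc x" "Suc x < 2 ^ Suc l" shows "length (nat_str x) = l"
proof -
  obtain w where w: "w < 2 ^ length (nat_str x)" "Suc x = 2 ^ length (nat_str x) + w"
    using str_code_append[of "nat_str x" "[]"] by (auto simp: str_code_Nil)
  have "(2 :: nat) ^ l < 2 ^ Suc (length (nat_str x))" "(2 :: nat) ^ length (nat_str x) < 2 ^ Suc l"
    using w assms by auto
  from this[THEN power_less_imp_less_exp[rotated]] show ?thesis by simp
qed

lemma length_nat_str_conv_Least: "length (nat_str x) = (LEAST l. Suc x < 2 ^ Suc l)"
proof -
  obtain w where w: "w < 2 ^ length (nat_str x)" "Suc x = 2 ^ length (nat_str x) + w"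
    using str_code_append[of "nat_str x" "[]"] by (auto simp: str_code_Nil)
  show ?thesis
  proof (rule Least_equality[symmetric])
    show "Suc x < 2 ^ Suc (length (nat_str x))" using w by simp
    fix l assume "Suc x < 2 ^ Suc l"
    with w have "(2 :: nat) ^ length (nat_str x) < 2 ^ Suc l" by simp
    from power_less_imp_less_exp[OF _ this] show "length (nat_str x) \<le> l" by simp
  qed
qed

lemma computable_length_nat_str [computable_intros]:
  assumes "computable f" shows "computable (\<lambda>x. length (nat_str (f x)))"
proof -
  have "\<exists>l. Suc x < 2 ^ Suc l" for x :: nat
    by (intro exI[of _ x]) (metis Suc_lessD less_exp lessI less_trans_Suc Suc_less_eq)
  then have "computable (\<lambda>x. LEAST l. Suc x < 2 ^ Suc l)"
    by (intro computable_intros) auto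
  from computable_comp[OF this assms] show ?thesis by (simp only: length_nat_str_conv_Least)
qed

text \<open>On codes, \<open>(y - 1) div 2\<close> drops the last bit, and a nonempty string ends in
  \<open>True\<close> iff its code is even. Bit p is last once all bits after it are
  dropped.\<close>

lemma nat_str_nth_iff:
  "p < length (nat_str x) \<Longrightarrow>
    nat_str x ! p \<longleftrightarrow> even (rec_nat x (\<lambda>_ y. (y - 1) div 2) (length (nat_str x) - Suc p))"
proof -
  have "rec_nat (str_code s) (\<lambda>_ y. (y - 1) div 2) k = str_code (take (length s - k) s)"
    if "k \<le> length s" for s k
    using that
  proof (induction k)
    case (Suc k)
    then have "take (length s - k) s = take (length s - Suc k) s @ [s ! (length s - Suc k)]"
      by (metis Suc_diff_Suc Suc_le_lessD diff_less length_greater_0_conv list.size(3) not_less_zero take_Suc_conv_app_nth zero_less_Suc)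
    with Suc show ?case by (simp add: str_code_snoc)
  qed simp
  from this[of "length (nat_str x) - Suc p" "nat_str x"]
  show "p < length (nat_str x) \<Longrightarrow> ?thesis"
    by (simp add: take_Suc_conv_app_nth str_code_snoc)
qed

text \<open>The bound on the position belongs to the predicate, since \<open>!\<close> is
  unspecified beyond the length.\<close>

lemma decidable_nat_str_nth:
  fixes p :: "'a :: coded \<Rightarrow> nat"
  assumes "computable f" "computable p"
  shows "decidable (\<lambda>x. p x < length (nat_str (f x)) \<and> nat_str (f x) ! p x)"
proof -
  \<comment> \<open>Halving is expressed as a search, for which a computability rule exists.\<close>
  let ?half = "\<lambda>y :: nat. LEAST z. y \<le> 2 * z + 2"
  have half: "?half y = (y - 1) div 2" for y
    by (rule Least_equality) auto
  have "computable (\<lambda>y. ?half y)"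
    by (intro computable_intros) (metis le_add1 mult_2 trans_le_add1)
  then have "computable (\<lambda>y. (y - 1) div 2 :: nat)" by (simp only: half)
  note c = computable_comp[OF this]
  have "decidable (\<lambda>x. p x < length (nat_str (f x)) \<and>
      (\<exists>z<Suc (rec_nat (f x) (\<lambda>_ y. (y - 1) div 2) (length (nat_str (f x)) - Suc (p x))).
        rec_nat (f x) (\<lambda>_ y. (y - 1) div 2) (length (nat_str (f x)) - Suc (p x)) = 2 * z))"
    by (intro computable_intros c computable_comp[OF assms(1)] computable_comp[OF assms(2)] assms)
  moreover have ev: "even y \<longleftrightarrow> (\<exists>z<Suc y. y = 2 * z)" for y :: nat
    by presburger
  have "(i < length (nat_str y) \<and> nat_str y ! i) \<longleftrightarrow> (i < length (nat_str y) \<and>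
      (\<exists>z<Suc (rec_nat y (\<lambda>_ y. (y - 1) div 2) (length (nat_str y) - Suc i)).
        rec_nat y (\<lambda>_ y. (y - 1) div 2) (length (nat_str y) - Suc i) = 2 * z))" for i y
    using nat_str_nth_iff[of i y] ev by blast
  ultimately show ?thesis by (simp only:)
qed


section \<open>Prefix-free machines\<close>

text \<open>Extending different members of P to a common length L gives disjoint sets, of size 2^(L
  - length p), among the 2^L strings of length L. The sum of all lengths is a convenient L.\<close>

lemma kraft_inequality:
  fixes P :: "bool list set"
  assumes "finite P" and prefix_free: "\<And>p q. p \<in> P \<Longrightarrow> q \<in> P \<Longrightarrow> prefix p q \<Longrightarrow> p = q"
  shows "(\<Sum>p\<in>P. 1 / 2 ^ length p) \<le> (1 :: real)"
proof -
  define L where "L = (\<Sum>p\<in>P. length p)"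
  have L: "length p \<le> L" if "p \<in> P" for p
    unfolding L_def using assms(1) that by (simp add: member_le_sum)
  define E where "E p = (\<lambda>q. p @ q) ` {q :: bool list. length q = L - length p}" for p
  have key: "us = []" if "q @ us \<in> P" "q \<in> P" for q us
    using prefix_free[OF that(2,1)] by simp
  have fin: "finite {q :: bool list. length q = n}" and card: "card {q :: bool list. length q = n} = 2 ^ n" for n
    using finite_lists_length_eq[of "UNIV :: bool set" n] card_lists_length_eq[of "UNIV :: bool set" n]
    by simp_all
  have "(\<Sum>p\<in>P. 2 ^ (L - length p)) = (\<Sum>p\<in>P. card (E p))"
    by (simp add: E_def card_image inj_on_def card)
  also have "\<dots> = card (\<Union>p\<in>P. E p)"
  proof (rule card_UN_disjoint[symmetric, OF assms(1)])
    show "\<forall>p\<in>P. finite (E p)" by (simp add: E_def fin)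
    show "\<forall>p\<in>P. \<forall>q\<in>P. p \<noteq> q \<longrightarrow> E p \<inter> E q = {}"
      unfolding E_def by (auto simp: append_eq_append_conv2 dest: key)
  qed
  also have "\<dots> \<le> card {q :: bool list. length q = L}"
    by (rule card_mono[OF fin]) (auto simp: E_def L)
  finally have "(\<Sum>p\<in>P. 2 ^ (L - length p)) \<le> (2 :: nat) ^ L" by (simp add: card)
  then have le: "real (\<Sum>p\<in>P. 2 ^ (L - length p)) \<le> 2 ^ L"
    by (metis of_nat_le_iff of_nat_numeral of_nat_power)
  have "1 / 2 ^ length p = (2 ^ (L - length p) / 2 ^ L :: real)" if "p \<in> P" for p
  proof -
    have "(2 :: real) ^ L = 2 ^ length p * 2 ^ (L - length p)"
      using L[OF that] by (simp flip: power_add)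
    then show ?thesis by simp
  qed
  then have "(\<Sum>p\<in>P. 1 / 2 ^ length p) = real (\<Sum>p\<in>P. 2 ^ (L - length p)) / 2 ^ L"
    by (simp add: sum_divide_distrib)
  also have "\<dots> \<le> 1" using le by simp
  finally show ?thesis .
qed

text \<open>Turns an enumeration of programs with their outputs into a machine: the search for the
  argument in the range of f diverges exactly outside that range.\<close>

lemma partial_recursive_search:
  fixes f out :: "nat \<Rightarrow> nat"
  assumes "computable f" "computable out"
  shows "partial_recursive 1 (\<lambda>xs.
    if \<exists>n. f n = xs ! 0 then Some (out (LEAST n. f n = xs ! 0)) else None)"
proof -
  have "computable (\<lambda>p. of_bool (f (fst p) \<noteq> snd p) :: nat)"
    by (intro computable_intros computable_comp[OF assms(1)])
  from recursive_computable[OF this, of 2 "\<lambda>ys. prod_encode (ys ! 0, ys ! 1)"]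
  have "recursive 2 (\<lambda>ys. of_bool (f (ys ! 0) \<noteq> ys ! 1))"
    by (simp add: dec_prod recursive_prod_encode recursive_nth)
  then obtain F where "\<And>ys. length ys = 2 \<Longrightarrow> evaluates F ys (of_bool (f (ys ! 0) \<noteq> ys ! 1))"
    unfolding recursive_def by blast
  from this[of "[_, _]"] have F: "evaluates F [n, x] (of_bool (f n \<noteq> x))" for n x by simp
  obtain Q where "\<And>ys. length ys = 1 \<Longrightarrow> evaluates Q ys (out (ys ! 0))"
    using assms(2) unfolding computable_def recursive_def by auto
  from this[of "[_]"] have Q: "evaluates Q [n] (out n)" for n by simp
  have "evaluates (Comp Q [Mu F]) [x] y \<longleftrightarrow>
      (\<exists>n. f n = x) \<and> y = out (LEAST n. f n = x)" (is "?L \<longleftrightarrow> ?R") for x y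
  proof
    assume ?L
    then obtain ys where "list_all2 (\<lambda>g. evaluates g [x]) [Mu F] ys" "evaluates Q ys y"
      by (cases rule: evaluates.cases) auto
    then obtain n where n: "evaluates (Mu F) [x] n" "evaluates Q [n] y"
      by (auto simp: list_all2_Cons1)
    from n(1) have m: "evaluates F [n, x] 0" "\<forall>m<n. \<exists>z. evaluates F [m, x] (Suc z)"
      by (cases rule: evaluates.cases; auto)+
    have "f n = x"
      using evaluates_deterministic[OF m(1) F] by simp
    moreover have "f i \<noteq> x" if "i < n" for i
      using m(2) that evaluates_deterministic[OF _ F, of i x] by fastforce
    ultimately have "(LEAST n. f n = x) = n"
      by (intro Least_equality) (auto simp: not_less[symmetric])
    with \<open>f n = x\<close> evaluates_deterministic[OF n(2) Q] show ?R by auto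
  next
    assume R: ?R
    let ?n = "LEAST n. f n = x"
    have "f ?n = x" using R by (metis (mono_tags, lifting) LeastI)
    then have "evaluates F [?n, x] 0" using F[of ?n x] by simp
    moreover have "evaluates F [i, x] (Suc 0)" if "i < ?n" for i
      using F[of i x] not_less_Least[OF that] by simp
    ultimately have "evaluates (Mu F) [x] ?n"
      by (intro evaluates.intros) auto
    with Q[of ?n] R show ?L by (auto intro!: evaluates.intros(4)[where ys = "[?n]"])
  qed
  then show ?thesis
    unfolding partial_recursive_def
    by (intro exI[of _ "Comp Q [Mu F]"]) (auto simp: length_Suc_conv)
qed

text \<open>The greedy form of the Kraft-Chaitin theorem: the interval for a request of length \<open>r\<close> starts at
  the next multiple of \<open>2\<^sup>-\<^sup>r\<close>, which wastes less than the length of the interval itself, so that a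
  total weight of at most \<open>1/2\<close> suffices.\<close>

theorem prefix_free_machine_of_requests:
  fixes r out :: "nat \<Rightarrow> nat"
  assumes r: "computable r" and out: "computable out"
    and weight: "\<And>J. (\<Sum>j<J. 1 / 2 ^ r j) \<le> (1 / 2 :: real)"
  obtains M where "prefix_free_machine M"
    "\<And>j. \<exists>p. M p = Some (nat_str (out j)) \<and> length p = r j"
proof -
  let ?next = "\<lambda>j q. LEAST v. fst q * 2 ^ r j \<le> v * 2 ^ snd q"
  \<comment> \<open>\<open>pos j\<close> stores the right end m / 2^e of the previous interval as
    (m, e), and \<open>?next\<close> rounds it up to a multiple of 2^(-r j). The interval of request
    j then starts at \<open>v j / 2 ^ r j\<close>.\<close>
  define pos where "pos = rec_nat (0, 0) (\<lambda>j q. (Suc (?next j q), r j))"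
  define v where "v j = ?next j (pos j)" for j
  have pos_Suc: "pos (Suc j) = (Suc (v j), r j)" for j
    by (simp add: pos_def v_def)
  have ex: "\<exists>v. a * 2 ^ b \<le> v * (2 :: nat) ^ d" for a b d
    by (intro exI[of _ "a * 2 ^ b"]) simp
  have "computable (\<lambda>j. rec_nat (0, 0) (\<lambda>j q. (Suc (?next j q), r j)) j)"
    by (intro computable_intros computable_comp[OF r] ex)
  then have pos: "computable pos" by (simp add: pos_def)
  have v: "computable v"
    unfolding v_def by (intro computable_intros computable_comp[OF r] computable_comp[OF pos] ex)
  \<comment> \<open>By the shape of \<open>str_code\<close>, this codes the binary expansion of
    \<open>v j\<close> with exactly \<open>r j\<close> digits.\<close>
  define code where "code j = 2 ^ r j + v j - 1" for j
  have code: "computable code"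
    unfolding code_def by (intro computable_intros computable_comp[OF r] computable_comp[OF v])
  have Suc_code: "Suc (code j) = 2 ^ r j + v j" for j by (simp add: code_def)

  define x where "x j = real (fst (pos j)) / 2 ^ snd (pos j)" for j
  have x_Suc: "x (Suc j) = (real (v j) + 1) / 2 ^ r j" for j
    by (simp add: x_def pos_Suc)
  have v_ge: "x j \<le> real (v j) / 2 ^ r j" for j
  proof -
    have "fst (pos j) * 2 ^ r j \<le> v j * 2 ^ snd (pos j)"
      unfolding v_def by (rule LeastI_ex[OF ex])
    then have "real (fst (pos j) * 2 ^ r j) \<le> real (v j * 2 ^ snd (pos j))"
      by (simp only: of_nat_le_iff)
    then show ?thesis by (simp add: x_def field_simps)
  qed
  have v_le: "real (v j) / 2 ^ r j \<le> x j + 1 / 2 ^ r j" for j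
  proof (cases "v j")
    case 0
    then show ?thesis by (simp add: x_def)
  next
    case (Suc w)
    then have "\<not> fst (pos j) * 2 ^ r j \<le> w * 2 ^ snd (pos j)"
      unfolding v_def by (intro not_less_Least) simp
    then have "real (w * 2 ^ snd (pos j)) \<le> real (fst (pos j) * 2 ^ r j)"
      by (simp only: of_nat_le_iff)
    with Suc show ?thesis by (simp add: x_def field_simps)
  qed
  have x_le: "x j \<le> 2 * (\<Sum>i<j. 1 / 2 ^ r i)" for j
  proof (induction j)
    case (Suc j)
    with v_le[of j] show ?case by (simp add: x_Suc add_divide_distrib)
  qed (simp add: x_def pos_def)
  \<comment> \<open>Total weight at most 1/2 keeps the right end at most 1, so \<open>v j\<close>
    fits into \<open>r j\<close> digits.\<close>
  have v_less: "v j < 2 ^ r j" for j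
  proof -
    have "(real (v j) + 1) / 2 ^ r j \<le> 1"
      using x_le[of "Suc j"] weight[of "Suc j"] unfolding x_Suc by linarith
    then have "real (Suc (v j)) \<le> real (2 ^ r j)" by (simp add: field_simps)
    then show ?thesis by (simp only: of_nat_le_iff Suc_le_eq)
  qed
  have length_code: "length (nat_str (code j)) = r j" for j
    using v_less[of j] by (intro length_nat_str_eqI) (simp_all add: Suc_code)
  have x_mono: "x i \<le> x j" if "i \<le> j" for i j
    using that
  proof (induction j rule: dec_induct)
    case (step n)
    have "x n \<le> x (Suc n)"
      using v_ge[of n] by (simp add: x_Suc add_divide_distrib add_increasing2)
    with step show ?case by simp
  qed simp
  have disjoint: "(real (v i) + 1) / 2 ^ r i \<le> real (v j) / 2 ^ r j" if "i < j" for i j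
    using x_mono[of "Suc i" j] v_ge[of j] that by (simp add: x_Suc)
  \<comment> \<open>A prefix relation puts the left end of interval j into interval i, which
    disjointness excludes for i \<noteq> j.\<close>
  have prefix_free: "i = j" if "prefix (nat_str (code i)) (nat_str (code j))" for i j
  proof -
    from that obtain q where q: "nat_str (code j) = nat_str (code i) @ q" by (auto simp: prefix_def)
    then obtain w where w: "w < 2 ^ length q" "Suc (code j) = Suc (code i) * 2 ^ length q + w"
      by (metis str_code_append str_code_nat_str)
    have rj: "r j = r i + length q" using q length_code by (metis length_append)
    then have "v j = v i * 2 ^ length q + w"
      using w(2) by (simp add: Suc_code power_add algebra_simps)
    then have vj: "real (v j) / 2 ^ r j = real (v i) / 2 ^ r i + real w / 2 ^ r j"
      by (simp add: rj power_add field_simps)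
    moreover have "real w < 2 ^ length q" using w(1) by (metis of_nat_less_iff of_nat_numeral of_nat_power)
    then have "real w / 2 ^ r j < 1 / 2 ^ r i" by (simp add: rj power_add field_simps)
    ultimately have "real (v i) / 2 ^ r i \<le> real (v j) / 2 ^ r j" 
      "real (v j) / 2 ^ r j < (real (v i) + 1) / 2 ^ r i" 
      by (simp_all add: add_divide_distrib)
    moreover have "real (v j) / 2 ^ r j < (real (v j) + 1) / 2 ^ r j" by (simp add: field_simps)
    ultimately show "i = j"
      using disjoint[of i j] disjoint[of j i] by (cases rule: linorder_cases[of i j]) auto
  qed
  have code_inj: "code i = code j \<longleftrightarrow> i = j" for i j
    using prefix_free[of i j] by auto

  define M where "M p = (if \<exists>j. code j = str_code p
    then Some (nat_str (out (LEAST j. code j = str_code p))) else None)" for p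
  have "M p \<noteq> None \<Longrightarrow> \<exists>j. p = nat_str (code j)" for p
    by (auto simp: M_def split: if_splits) (metis nat_str_str_code)
  then have "\<forall>p\<in>dom M. \<forall>q\<in>dom M. prefix p q \<longrightarrow> p = q"
    unfolding dom_def using prefix_free by blast
  moreover have "(\<lambda>xs. map_option str_code (M (nat_str (xs ! 0))))
      = (\<lambda>xs. if \<exists>n. code n = xs ! 0 then Some (out (LEAST n. code n = xs ! 0)) else None)"
    by (auto simp: M_def)
  ultimately have "prefix_free_machine M"
    using partial_recursive_search[OF code out] by (simp add: prefix_free_machine_def)
  moreover have "M (nat_str (code j)) = Some (nat_str (out j))" for j
    by (auto simp: M_def code_inj Least_equality)
  ultimately show ?thesis using that length_code by blast
qed


section \<open>Optimal machines\<close>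

text \<open>A machine with a program of length j + 2 for the j-th string exists, as these requests
  weigh less than 1/2. Optimality then puts every string into the range of U, so the minimum
  defining \<open>K\<close> is attained.\<close>

lemma optimal_machine_range:
  assumes "optimal_prefix_free_machine U"
  shows "\<exists>p. U p = Some s \<and> length p = K U s"
proof -
  have "(\<Sum>j<J. 1 / 2 ^ (j + 2)) \<le> (1 / 2 :: real)" for J
  proof -
    have "(\<Sum>j<J. 1 / 2 ^ (j + 2)) = (1 / 2 - 1 / 2 ^ (J + 1) :: real)"
      by (induction J) (auto simp: field_simps)
    then show ?thesis by simp
  qed
  moreover have "computable (\<lambda>j :: nat. j + 2)" "computable (\<lambda>j :: nat. j)"
    by (intro computable_intros)+
  ultimately obtain M where M: "prefix_free_machine M"
    "\<And>j. \<exists>p. M p = Some (nat_str j) \<and> length p = j + 2"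
    using prefix_free_machine_of_requests[of "\<lambda>j. j + 2" "\<lambda>j. j"] by blast
  from M(2)[of "str_code s"] obtain p where "M p = Some s" by auto
  with M(1) assms have "\<exists>k q. U q = Some s \<and> length q = k"
    unfolding optimal_prefix_free_machine_def by metis
  then show ?thesis unfolding K_def by (rule LeastI_ex)
qed

lemma K_le_machine:
  assumes "optimal_prefix_free_machine U" "prefix_free_machine M"
  obtains c where "\<And>p s. M p = Some s \<Longrightarrow> K U s \<le> length p + c"
proof -
  obtain c where c: "\<And>p s. M p = Some s \<Longrightarrow> \<exists>q. U q = Some s \<and> length q \<le> length p + c"
    using assms unfolding optimal_prefix_free_machine_def by blast
  have "K U s \<le> length p + c" if "M p = Some s" for p s
  proof -
    from c[OF that] obtain q where q: "U q = Some s" "length q \<le> length p + c" by blast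
    from q(1) have "K U s \<le> length q" unfolding K_def by (intro Least_le) blast
    with q(2) show ?thesis by simp
  qed
  then show thesis by (rule that)
qed

lemma sum_K_nat_le_1:
  assumes "optimal_prefix_free_machine U"
  shows "(\<Sum>n<s. 1 / 2 ^ K_nat U n) \<le> (1 :: real)"
proof -
  have "\<forall>n. \<exists>p. U p = Some (nat_str n) \<and> length p = K_nat U n"
    unfolding K_nat_def by (intro allI optimal_machine_range[OF assms])
  then obtain p where "\<forall>n. U (p n) = Some (nat_str n) \<and> length (p n) = K_nat U n"
    by (rule choice[THEN exE])
  then have p: "\<And>n. U (p n) = Some (nat_str n)" "\<And>n. length (p n) = K_nat U n" by blast+
  have inj: "inj_on p {..<s}"
    using p(1) by (metis inj_onI nat_str_def option.inject str_code_nat_str)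
  have "(\<Sum>n<s. 1 / 2 ^ K_nat U n) = (\<Sum>q\<in>p ` {..<s}. 1 / 2 ^ length q :: real)"
    by (simp add: sum.reindex[OF inj] p(2))
  also have "\<dots> \<le> 1"
    using assms p(1) unfolding optimal_prefix_free_machine_def prefix_free_machine_def
    by (intro kraft_inequality) (auto simp: dom_def)
  finally show ?thesis .
qed

lemma prefix_free_machine_enumeration:
  assumes "prefix_free_machine M"
  obtains u :: "nat \<Rightarrow> nat \<Rightarrow> nat" where "computable (\<lambda>p. u (fst p) (snd p))"
    "\<And>s s' x y. u s x = Suc y \<Longrightarrow> s \<le> s' \<Longrightarrow> u s' x = Suc y"
    "\<And>x y. (\<exists>s. u s x = Suc y) \<longleftrightarrow> M (nat_str x) = Some (nat_str y)"
proof -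
  obtain f where "\<And>xs y. length xs = 1 \<Longrightarrow>
      evaluates f xs y \<longleftrightarrow> map_option str_code (M (nat_str (xs ! 0))) = Some y"
    using assms unfolding prefix_free_machine_def partial_recursive_def by blast
  from this[of "[_]"] have f: "evaluates f [x] y \<longleftrightarrow> M (nat_str x) = Some (nat_str y)" for x y
    by auto
  show thesis
  proof (rule that[of "\<lambda>s x. run f s [x]"])
    show "computable (\<lambda>p. run f (fst p) [snd p])"
      by (intro computable_intros computable_comp2[OF computable_run])
    show "(\<exists>s. run f s [x] = Suc y) \<longleftrightarrow> M (nat_str x) = Some (nat_str y)" for x y
      unfolding f[symmetric] using run_sound run_complete by blast
  qed (rule run_mono)
qed

section \<open>The construction\<close>

text \<open>Bounds the number of subsets of the markers by a sum over single markers, so that costs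
  can be charged marker by marker. A new maximum b doubles the left side, and
  \<open>card I \<le> b\<close> as I lies below b.\<close>

lemma power_card_le_sum_powers:
  fixes I :: "nat set"
  assumes "finite I" shows "(2 :: real) ^ card I \<le> 1 + (\<Sum>i\<in>I. 2 ^ i)"
  using assms
proof (induction I rule: finite_linorder_max_induct)
  case (insert b I)
  then have "I \<subseteq> {..<b}" "b \<notin> I" by auto
  then have "card I \<le> b" by (metis card_lessThan card_mono finite_lessThan)
  then have "(2 :: real) ^ card I \<le> 2 ^ b" by simp
  moreover have "(2 :: real) ^ card (insert b I) = 2 ^ card I + 2 ^ card I"
    "(\<Sum>i\<in>insert b I. 2 ^ i) = 2 ^ b + (\<Sum>i\<in>I. 2 ^ i :: real)"
    using insert.hyps(1) \<open>b \<notin> I\<close> by simp_all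
  ultimately show ?case using insert.IH by linarith
qed simp

text \<open>A pair is bounded componentwise by its code, so the first J pairs lie in a J by J
  square.\<close>

lemma sum_prod_decode_le:
  fixes f :: "nat \<times> nat \<Rightarrow> real"
  assumes "\<And>q. 0 \<le> f q"
  shows "(\<Sum>j<J. f (prod_decode j)) \<le> (\<Sum>s<J. \<Sum>x<J. f (s, x))"
proof -
  have inj: "inj_on prod_decode {..<J}" by (metis inj_onI prod_decode_inverse)
  have "prod_decode j \<in> {..<J} \<times> {..<J}" if "j < J" for j
    using that le_prod_encode_1[of "fst (prod_decode j)" "snd (prod_decode j)"]
      le_prod_encode_2[of "snd (prod_decode j)" "fst (prod_decode j)"]
    by (simp add: mem_Times_iff)
  then have "prod_decode ` {..<J} \<subseteq> {..<J} \<times> {..<J}" by blast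
  then have "sum f (prod_decode ` {..<J}) \<le> sum f ({..<J} \<times> {..<J})"
    using assms by (intro sum_mono2) auto
  then show ?thesis by (simp add: sum.reindex[OF inj] sum.cartesian_product)
qed

text \<open>\<open>u s x = Suc y\<close> means that by stage \<open>s\<close> the universal machine has produced the string with code
  \<open>y\<close> from the program with code \<open>x\<close>; \<open>u s x = 0\<close> means that it has not halted yet.\<close>

locale gap_approximation =
  fixes h u :: "nat \<Rightarrow> nat \<Rightarrow> nat" and C :: real
  assumes h_antimono: "s \<le> s' \<Longrightarrow> h n s' \<le> h n s"
    and u_mono: "u s x = Suc y \<Longrightarrow> s \<le> s' \<Longrightarrow> u s' x = Suc y"
    and u_prefix_free: "0 < u s x \<Longrightarrow> 0 < u s x' \<Longrightarrow> prefix (nat_str x) (nat_str x') \<Longrightarrow> x = x'"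
    and weight_le_C: "(\<Sum>n<s. 1 / 2 ^ h n s) \<le> C"
    and gap: "\<exists>N. \<forall>n\<ge>N. \<exists>x s. u s x = Suc n \<and> (\<forall>t. length (nat_str x) + k \<le> h n t)"
begin

text \<open>Giving weight 0 to n \<ge> s keeps the sums finite and lets a new positive term enter at
  each stage, so that \<open>\<alpha>\<close> is strictly increasing.\<close>

definition a :: "nat \<Rightarrow> nat \<Rightarrow> real" where
  "a s n = (if n < s then 1 / 2 ^ h n s else 0)"

definition \<alpha> :: "nat \<Rightarrow> real" where
  "\<alpha> s = (\<Sum>n<s. a s n)"

text \<open>A program \<open>x\<close> for \<open>n\<close> contributes at most \<open>2\<^bsup>-h n s + 2 i + 1\<^esup>\<close> even if its own weight is larger, so
  that \<open>\<beta> i\<close> cannot run ahead of \<open>\<alpha>\<close>: where the gap is at least \<open>2 i + 1\<close>, the remaining growth of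
  \<open>\<beta> i\<close> is at least \<open>2\<^bsup>2 i + 1\<^esup>\<close> times that of \<open>\<alpha>\<close>.\<close>

definition b :: "nat \<Rightarrow> nat \<Rightarrow> nat \<Rightarrow> real" where
  "b i s x = (if x < s \<and> 0 < u s x \<and> u s x \<le> s
    then 1 / 2 ^ max (length (nat_str x)) (h (u s x - 1) s - (2 * i + 1)) else 0)"

definition \<beta> :: "nat \<Rightarrow> nat \<Rightarrow> real" where
  "\<beta> i s = (\<Sum>x<s. b i s x)"

text \<open>The state \<open>(t', t)\<close> consists of the last two stages at which marker \<open>i\<close> was reset. The growth of
  \<open>\<beta> i\<close> between them is the budget, scaled by \<open>4\<^sup>-\<^sup>i\<close>, for the growth of \<open>\<alpha>\<close> since \<open>t\<close>.\<close>

definition keeps :: "nat \<Rightarrow> nat \<Rightarrow> nat \<times> nat \<Rightarrow> bool" where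
  "keeps i s q \<longleftrightarrow> \<alpha> (Suc s) + 1 / 2 ^ (2 * i) * \<beta> i (fst q) \<le> \<alpha> (snd q) + 1 / 2 ^ (2 * i) * \<beta> i (snd q)"

primrec state :: "nat \<Rightarrow> nat \<Rightarrow> nat \<times> nat" where
  "state i 0 = (0, 0)"
| "state i (Suc s) = (if keeps i s (state i s) then state i s else (snd (state i s), Suc s))"

text \<open>A reset at stage s moves the marker to i + Suc s, beyond all strings of length at most
  s. The summand i bounds the search in \<open>on_tree\<close> and makes the set of limit positions
  infinite.\<close>

definition marker :: "nat \<Rightarrow> nat \<Rightarrow> nat" where
  "marker i s = i + snd (state i s)"

definition on_tree :: "nat \<Rightarrow> bool list \<Rightarrow> bool" where
  "on_tree s \<sigma> \<longleftrightarrow> (\<forall>p<length \<sigma>. \<sigma> ! p \<longrightarrow> (\<exists>i<Suc p. marker i s = p))"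

text \<open>Requests are made when a length enters, at stage s = n, and whenever h n decreases. The
  tree is taken after the resets of the stage; these move markers beyond s, so no string of length
  at most s joins the tree later.\<close>

definition requested :: "nat \<Rightarrow> bool list \<Rightarrow> bool" where
  "requested s \<sigma> \<longleftrightarrow> length \<sigma> \<le> s \<and> (length \<sigma> = s \<or> h (length \<sigma>) (Suc s) < h (length \<sigma>) s) \<and>
    on_tree (Suc s) \<sigma>"

section \<open>Monotonicity and bounds of the approximations\<close>

lemma a_nonneg: "0 \<le> a s n"
  by (simp add: a_def)

lemma b_nonneg: "0 \<le> b i s x"
  by (simp add: b_def)

lemma \<alpha>_eq: "s \<le> r \<Longrightarrow> \<alpha> s = (\<Sum>n<r. a s n)"
  unfolding \<alpha>_def by (rule sum.mono_neutral_left) (auto simp: a_def)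

lemma \<beta>_eq: "s \<le> r \<Longrightarrow> \<beta> i s = (\<Sum>x<r. b i s x)"
  unfolding \<beta>_def by (rule sum.mono_neutral_left) (auto simp: b_def)

lemma a_mono: "s \<le> s' \<Longrightarrow> a s n \<le> a s' n"
  using h_antimono[of s s' n] by (auto simp: a_def intro!: divide_left_mono power_increasing)

lemma b_mono: assumes "s \<le> s'" shows "b i s x \<le> b i s' x"
proof (cases "x < s \<and> 0 < u s x \<and> u s x \<le> s")
  case True
  then have u: "u s x = Suc (u s x - 1)" by simp
  from u_mono[OF this assms] u have "u s' x = u s x" by simp
  moreover have "h (u s x - 1) s' \<le> h (u s x - 1) s" by (rule h_antimono[OF assms])
  ultimately show ?thesis using True assms
    by (auto simp: b_def intro!: divide_left_mono power_increasing)
next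
  case False
  then have "b i s x = 0" unfolding b_def by (rule if_not_P)
  then show ?thesis using b_nonneg by simp
qed

lemma \<alpha>_mono: "s \<le> s' \<Longrightarrow> \<alpha> s \<le> \<alpha> s'"
  unfolding \<alpha>_eq[of s s'] \<alpha>_def[of s'] by (intro sum_mono a_mono)

lemma \<beta>_mono: "s \<le> s' \<Longrightarrow> \<beta> i s \<le> \<beta> i s'"
  unfolding \<beta>_eq[of s s'] \<beta>_def[of i s'] by (intro sum_mono b_mono)

lemma \<alpha>_less_Suc: "\<alpha> s < \<alpha> (Suc s)"
proof -
  have "\<alpha> s + 0 < (\<Sum>n<s. a (Suc s) n) + a (Suc s) s"
    unfolding \<alpha>_def by (intro add_le_less_mono sum_mono a_mono) (simp_all add: a_def)
  then show ?thesis by (simp add: \<alpha>_def)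
qed

lemma \<alpha>_le_C: "\<alpha> s \<le> C"
  using weight_le_C[of s] by (simp add: \<alpha>_def a_def)

lemma \<alpha>_nonneg: "0 \<le> \<alpha> s"
  unfolding \<alpha>_def by (intro sum_nonneg a_nonneg)

lemma \<beta>_nonneg: "0 \<le> \<beta> i s"
  unfolding \<beta>_def by (intro sum_nonneg b_nonneg)

lemma \<beta>_le_1: "\<beta> i s \<le> 1"
proof -
  let ?X = "{x. x < s \<and> 0 < u s x}"
  have inj: "inj_on nat_str ?X" by (metis inj_onI str_code_nat_str)
  have "\<beta> i s \<le> (\<Sum>x<s. if 0 < u s x then 1 / 2 ^ length (nat_str x) else 0)"
    unfolding \<beta>_def
    by (intro sum_mono) (auto simp: b_def intro!: divide_left_mono power_increasing)
  also have "\<dots> = (\<Sum>x\<in>?X. 1 / 2 ^ length (nat_str x))"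
    by (intro sum.mono_neutral_cong_right) auto
  also have "\<dots> = (\<Sum>p\<in>nat_str ` ?X. 1 / 2 ^ length p)"
    by (simp add: sum.reindex[OF inj])
  also have "\<dots> \<le> 1"
    using u_prefix_free by (intro kraft_inequality) auto
  finally show ?thesis .
qed

text \<open>Where the gap is at least 2 i + 1, a fixed program for n has, once halted, a term in
  \<open>\<beta> i\<close> of exactly 2^(2 i + 1) times the weight of n, and never a larger one
  before. The finitely many other n have final weights from S on and add nothing to the growth of
  \<open>\<alpha>\<close>. The stage s' may exceed r because the programs must have halted.\<close>

lemma \<beta>_growth:
  obtains S where
    "\<And>s r. S \<le> s \<Longrightarrow> s \<le> r \<Longrightarrow> \<exists>s'\<ge>r. 2 ^ (2 * i + 1) * (\<alpha> r - \<alpha> s) \<le> \<beta> i s' - \<beta> i s"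
proof -
  let ?k = "2 * i + 1"
  obtain N where "\<forall>n\<ge>N. \<exists>x s. u s x = Suc n \<and> (\<forall>t. length (nat_str x) + ?k \<le> h n t)"
    using gap by blast
  then obtain x e where x: "\<And>n. N \<le> n \<Longrightarrow> u (e n) (x n) = Suc n"
    "\<And>n t. N \<le> n \<Longrightarrow> length (nat_str (x n)) + ?k \<le> h n t"
    by metis
  have "\<exists>S. \<forall>s\<ge>S. h n s = h n S" for n
  proof -
    let ?m = "LEAST m. \<exists>s. h n s = m"
    obtain S where S: "h n S = ?m"
      using LeastI_ex[of "\<lambda>m. \<exists>s. h n s = m"] by blast
    have "?m \<le> h n s" for s by (rule Least_le) blast
    then have "h n s = h n S" if "S \<le> s" for s
      using h_antimono[OF that, of n] S by (metis le_antisym)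
    then show ?thesis by blast
  qed
  then obtain S where S: "\<And>n s. S n \<le> s \<Longrightarrow> h n s = h n (S n)" by metis
  \<comment> \<open>The summand N ensures that every n < N is already counted in
    \<open>\<alpha>\<close>.\<close>
  define S0 where "S0 = N + (\<Sum>n<N. S n)"
  have early: "a r n = a s n" if "S0 \<le> s" "s \<le> r" "n < N" for s r n
  proof -
    have "S n \<le> (\<Sum>n<N. S n)" using that by (intro member_le_sum) auto
    then show ?thesis using that S[of n s] S[of n r] by (simp add: a_def S0_def)
  qed
  have "\<exists>s'\<ge>r. 2 ^ ?k * (\<alpha> r - \<alpha> s) \<le> \<beta> i s' - \<beta> i s" if s: "S0 \<le> s" "s \<le> r" for s r
  proof -
    define s' where "s' = Suc (r + (\<Sum>n=N..<r. x n + e n))"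
    have s': "r \<le> s'" "s \<le> s'" using s by (auto simp: s'_def)
    have xs': "x n < s'" "u s' (x n) = Suc n" if "n \<in> {N..<r}" for n
    proof -
      have "x n + e n \<le> (\<Sum>n=N..<r. x n + e n)"
        using that by (intro member_le_sum) auto
      then have "x n < s'" "e n \<le> s'" by (simp_all add: s'_def)
      then show "x n < s'" "u s' (x n) = Suc n"
        using u_mono[OF x(1)[of n], of s'] that by auto
    qed
    have inj: "inj_on x {N..<r}"
      by (rule inj_onI) (metis Suc_inject xs'(2))
    have term_le: "2 ^ ?k * (a r n - a s n) \<le> b i s' (x n) - b i s (x n)" if n: "n \<in> {N..<r}" for n
    proof -
      have k: "length (nat_str (x n)) + ?k \<le> h n t" for t using x(2) n by simp
      have w: "1 / 2 ^ max (length (nat_str (x n))) (h n t - ?k)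
          = 2 ^ ?k * (1 / 2 ^ h n t :: real)" for t
      proof -
        have "h n t = ?k + (h n t - ?k)" using k[of t] by simp
        then have "(2 :: real) ^ h n t = 2 ^ ?k * 2 ^ (h n t - ?k)" by (metis power_add)
        moreover have "max (length (nat_str (x n))) (h n t - ?k) = h n t - ?k" using k[of t] by simp
        ultimately show ?thesis by (simp only:) simp
      qed
      have "b i s' (x n) = 2 ^ ?k * (1 / 2 ^ h n s')"
        using xs'[OF n] n s' w[of s'] by (simp add: b_def)
      moreover have "a r n \<le> 1 / 2 ^ h n s'"
        using a_mono[OF s'(1), of n] n s' by (simp add: a_def)
      moreover have "b i s (x n) \<le> 2 ^ ?k * a s n"
      proof (cases "x n < s \<and> 0 < u s (x n) \<and> u s (x n) \<le> s")
        case True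
        then have "u s (x n) = Suc n"
          using u_mono[OF _ s'(2), of "x n" "u s (x n) - 1"] xs'(2)[OF n] by simp
        \<comment> \<open>The condition \<open>u s x \<le> s\<close> in \<open>b\<close> yields n <
          s here, so \<open>a s n\<close> is the full weight and not 0.\<close>
        with True w[of s] show ?thesis by (simp add: b_def a_def)
      next
        case False
        then have "b i s (x n) = 0" unfolding b_def by (rule if_not_P)
        then show ?thesis using a_nonneg by simp
      qed
      ultimately show ?thesis
        using mult_left_mono[of "a r n" "1 / 2 ^ h n s'" "2 ^ ?k"] by (simp add: right_diff_distrib)
    qed
    have "\<alpha> r - \<alpha> s = (\<Sum>n<r. a r n - a s n)"
      unfolding \<alpha>_eq[OF s(2)] \<alpha>_def[of r] by (simp add: sum_subtractf)
    also have "\<dots> = (\<Sum>n=N..<r. a r n - a s n)"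
      using early[OF s] by (intro sum.mono_neutral_right) (auto simp: not_le)
    finally have "2 ^ ?k * (\<alpha> r - \<alpha> s) = (\<Sum>n=N..<r. 2 ^ ?k * (a r n - a s n))"
      by (simp add: sum_distrib_left)
    also have "\<dots> \<le> (\<Sum>n=N..<r. b i s' (x n) - b i s (x n))"
      by (intro sum_mono term_le)
    also have "\<dots> = (\<Sum>y\<in>x ` {N..<r}. b i s' y - b i s y)"
      by (simp add: sum.reindex[OF inj])
    also have "\<dots> \<le> (\<Sum>y<s'. b i s' y - b i s y)"
      using xs'(1) b_mono[OF s'(2)] by (intro sum_mono2) auto
    also have "\<dots> = \<beta> i s' - \<beta> i s"
      unfolding \<beta>_eq[OF s'(2)] \<beta>_def[of i s'] by (simp add: sum_subtractf)
    finally show ?thesis using s'(1) by blast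
  qed
  then show thesis by (rule that)
qed

section \<open>Every marker settles\<close>

lemma state_le: "fst (state i s) \<le> snd (state i s)" "snd (state i s) \<le> s"
  by (induction s) auto

lemma snd_state_mono: "s \<le> s' \<Longrightarrow> snd (state i s) \<le> snd (state i s')"
proof (induction s' rule: dec_induct)
  case (step s')
  then show ?case using state_le(2)[of i s'] by auto
qed simp

text \<open>If marker \<open>i\<close> is reset infinitely often, then, measured from a late reset, \<open>\<beta> i\<close> grows at most
  \<open>4\<^sup>i\<close> times as much as \<open>\<alpha>\<close>, whereas it has to grow \<open>2 \<cdot> 4\<^sup>i\<close> times as much.\<close>

lemma state_converges: "\<exists>S. \<forall>s\<ge>S. state i s = state i S"
proof (rule ccontr)
  assume "\<not> ?thesis"
  then have not_stable: "\<exists>s\<ge>S. state i s \<noteq> state i S" for S by blast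
  have reset: "\<exists>s\<ge>S. \<not> keeps i s (state i s)" for S
  proof (rule ccontr)
    assume *: "\<not> ?thesis"
    have "state i s = state i S" if "S \<le> s" for s
      using that by (induction s rule: dec_induct) (use * in auto)
    with not_stable show False by blast
  qed
  have snd_large: "\<exists>s\<ge>S. S \<le> snd (state i s)" for S
  proof -
    obtain s where "S \<le> s" "\<not> keeps i s (state i s)" using reset by blast
    then show ?thesis by (intro exI[of _ "Suc s"]) auto
  qed
  have fst_large: "\<exists>s\<ge>S. S \<le> fst (state i s)" for S
  proof -
    obtain s0 where s0: "S \<le> s0" "S \<le> snd (state i s0)" using snd_large by blast
    obtain s where s: "s0 \<le> s" "\<not> keeps i s (state i s)" using reset by blast
    then have "S \<le> snd (state i s)" using snd_state_mono[OF s(1), of i] s0 by simp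
    with s s0 show ?thesis by (intro exI[of _ "Suc s"]) auto
  qed
  let ?w = "1 / 2 ^ (2 * i) :: real"
  obtain S where S: "\<And>s r. S \<le> s \<Longrightarrow> s \<le> r \<Longrightarrow>
      \<exists>s'\<ge>r. 2 ^ (2 * i + 1) * (\<alpha> r - \<alpha> s) \<le> \<beta> i s' - \<beta> i s"
    by (rule \<beta>_growth[of i]) blast
  obtain s0 where s0: "S \<le> fst (state i s0)" using fst_large by blast
  let ?t' = "fst (state i s0)" and ?t = "snd (state i s0)"
  \<comment> \<open>Each failure of \<open>keeps\<close> bounds the scaled growth of
    \<open>\<beta> i\<close> over one interval by that of \<open>\<alpha>\<close> over the next; the
    bounds telescope, with the two sides shifted by one interval.\<close>
  have growth: "?w * (\<beta> i (fst (state i s)) - \<beta> i ?t') \<le> \<alpha> (snd (state i s)) - \<alpha> ?t" if "s0 \<le> s" for s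
    using that
  proof (induction s rule: dec_induct)
    case (step s)
    show ?case
    proof (cases "keeps i s (state i s)")
      case False
      then have "?w * (\<beta> i (snd (state i s)) - \<beta> i (fst (state i s))) \<le> \<alpha> (Suc s) - \<alpha> (snd (state i s))"
        by (simp add: keeps_def right_diff_distrib)
      with step.IH have "?w * (\<beta> i (snd (state i s)) - \<beta> i ?t') \<le> \<alpha> (Suc s) - \<alpha> ?t"
        by (simp add: right_diff_distrib)
      with False show ?thesis by simp
    qed (use step.IH in simp)
  qed simp
  \<comment> \<open>Letting r grow makes this twice the remaining growth of \<open>\<alpha>\<close>
    at most that growth itself, which is impossible since \<open>\<alpha>\<close> is strictly
    increasing.\<close>
  have "2 * (\<alpha> r - \<alpha> ?t') \<le> Sup (range \<alpha>) - \<alpha> ?t'" if r: "?t' \<le> r" for r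
  proof -
    obtain s' where s': "2 ^ (2 * i + 1) * (\<alpha> r - \<alpha> ?t') \<le> \<beta> i s' - \<beta> i ?t'"
      using S[OF s0 r] by blast
    obtain s where s: "s \<ge> s0 + s'" "s' \<le> fst (state i s)"
      using fst_large[of "s0 + s'"] by auto
    have "2 * (\<alpha> r - \<alpha> ?t') = ?w * (2 ^ (2 * i + 1) * (\<alpha> r - \<alpha> ?t'))" by simp
    also have "\<dots> \<le> ?w * (\<beta> i (fst (state i s)) - \<beta> i ?t')"
      using s' \<beta>_mono[OF s(2), of i] by (intro mult_left_mono) auto
    also have "\<dots> \<le> \<alpha> (snd (state i s)) - \<alpha> ?t" using s by (intro growth) simp
    also have "\<dots> \<le> Sup (range \<alpha>) - \<alpha> ?t'"
      using \<alpha>_le_C \<alpha>_mono[OF state_le(1)[of i s0]]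
      by (intro diff_mono cSup_upper) (auto simp: bdd_above_def)
    finally show ?thesis .
  qed
  then have *: "\<alpha> r \<le> (Sup (range \<alpha>) + \<alpha> ?t') / 2" if "?t' \<le> r" for r
    using that by (simp add: field_simps)
  have "\<alpha> r \<le> (Sup (range \<alpha>) + \<alpha> ?t') / 2" for r
    using *[of "max r ?t'"] \<alpha>_mono[of r "max r ?t'"] by simp
  then have "Sup (range \<alpha>) \<le> (Sup (range \<alpha>) + \<alpha> ?t') / 2"
    by (intro cSup_least) auto
  then have "Sup (range \<alpha>) \<le> \<alpha> ?t'" by simp
  moreover have "\<alpha> (Suc ?t') \<le> Sup (range \<alpha>)"
    using \<alpha>_le_C by (intro cSup_upper) (auto simp: bdd_above_def)
  ultimately show False using \<alpha>_less_Suc[of ?t'] by simp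
qed

section \<open>The total weight of the requests\<close>

lemma kept_growth_le:
  "(\<Sum>s<S. if keeps i s (state i s) then \<alpha> (Suc s) - \<alpha> s else 0) \<le> 1 / 2 ^ (2 * i)"
proof -
  let ?w = "1 / 2 ^ (2 * i) :: real"
  \<comment> \<open>Invariant with state (t', t): completed intervals are paid for by the scaled
    \<open>\<beta> i\<close> up to t', the current one by its growth from t' to t. The growth at a
    reset itself is not counted, so a reset turns the second bound into the new first one.\<close>
  have *: "(\<Sum>s<S. if keeps i s (state i s) then \<alpha> (Suc s) - \<alpha> s else 0)
        \<le> ?w * \<beta> i (fst (state i S)) + \<alpha> S - \<alpha> (snd (state i S)) \<and>
      \<alpha> S - \<alpha> (snd (state i S)) \<le> ?w * (\<beta> i (snd (state i S)) - \<beta> i (fst (state i S)))"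
  proof (induction S)
    case 0
    then show ?case by (simp add: \<beta>_nonneg)
  next
    case (Suc S)
    show ?case
    proof (cases "keeps i S (state i S)")
      case True
      with Suc show ?thesis by (simp add: keeps_def right_diff_distrib)
    next
      case False
      have "\<beta> i (snd (state i S)) \<le> \<beta> i (Suc S)"
        using state_le(2)[of i S] by (intro \<beta>_mono) simp
      with False Suc show ?thesis by (simp add: right_diff_distrib divide_right_mono)
    qed
  qed
  have "?w * \<beta> i (snd (state i S)) \<le> ?w * 1"
    by (intro mult_left_mono \<beta>_le_1) simp
  with * show ?thesis by (simp add: right_diff_distrib)
qed

lemma card_on_tree_le:
  "real (card {\<sigma>. length \<sigma> = n \<and> on_tree s \<sigma>}) \<le> 1 + (\<Sum>i | marker i s < n. 2 ^ i)"
proof -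
  let ?I = "{i. marker i s < n}"
  have fin: "finite ?I" by (rule finite_subset[of _ "{..<n}"]) (auto simp: marker_def)
  let ?f = "\<lambda>\<sigma> :: bool list. {p. p < n \<and> \<sigma> ! p}"
  have "inj_on ?f {\<sigma>. length \<sigma> = n \<and> on_tree s \<sigma>}"
  proof (rule inj_onI)
    fix \<sigma> \<tau> :: "bool list"
    assume "\<sigma> \<in> {\<sigma>. length \<sigma> = n \<and> on_tree s \<sigma>}" "\<tau> \<in> {\<sigma>. length \<sigma> = n \<and> on_tree s \<sigma>}" "?f \<sigma> = ?f \<tau>"
    then have "length \<sigma> = n" "length \<tau> = n" "\<And>p. p < n \<Longrightarrow> \<sigma> ! p = \<tau> ! p" by blast+
    then show "\<sigma> = \<tau>" by (simp add: list_eq_iff_nth_eq)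
  qed
  moreover have "?f ` {\<sigma>. length \<sigma> = n \<and> on_tree s \<sigma>} \<subseteq> Pow ((\<lambda>i. marker i s) ` ?I)"
    by (auto simp: on_tree_def)
  ultimately have "card {\<sigma>. length \<sigma> = n \<and> on_tree s \<sigma>} \<le> card (Pow ((\<lambda>i. marker i s) ` ?I))"
    using fin by (intro card_inj_on_le) auto
  also have "\<dots> \<le> 2 ^ card ?I"
    using fin by (simp add: card_Pow card_image_le)
  finally have "real (card {\<sigma>. length \<sigma> = n \<and> on_tree s \<sigma>}) \<le> 2 ^ card ?I"
    by (metis of_nat_le_iff of_nat_numeral of_nat_power)
  with power_card_le_sum_powers[OF fin] show ?thesis by linarith
qed

text \<open>If h n drops by at least 1, the new weight is at most twice its increase, whence the
  factor 2. A marker reset at this stage lies beyond s, so only kept markers with i < s count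
  strings of length at most s.\<close>

lemma stage_weight_le:
  "(\<Sum>\<sigma> | requested s \<sigma>. 1 / 2 ^ h (length \<sigma>) (Suc s))
    \<le> 2 * (\<alpha> (Suc s) - \<alpha> s) * (1 + (\<Sum>i<s. if keeps i s (state i s) then 2 ^ i else 0))"
proof -
  let ?N = "{n. n \<le> s \<and> (n = s \<or> h n (Suc s) < h n s)}"
  let ?L = "\<lambda>n. {\<sigma>. length \<sigma> = n \<and> on_tree (Suc s) \<sigma>}"
  let ?B = "1 + (\<Sum>i<s. if keeps i s (state i s) then 2 ^ i else 0) :: real"
  have B: "0 \<le> ?B" by (intro add_nonneg_nonneg sum_nonneg) auto
  have fin: "finite (?L n)" for n
    by (rule finite_subset[OF _ finite_lists_length_eq[of "UNIV :: bool set" n]]) auto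
  have card: "real (card (?L n)) \<le> ?B" if n: "n \<le> s" for n
  proof -
    have "i < s \<and> keeps i s (state i s)" if "marker i (Suc s) < n" for i
      using that n by (auto simp: marker_def split: if_splits)
    then have "(\<Sum>i | marker i (Suc s) < n. 2 ^ i) \<le> (\<Sum>i | i < s \<and> keeps i s (state i s). 2 ^ i :: real)"
      by (intro sum_mono2) auto
    also have "\<dots> = (\<Sum>i<s. if keeps i s (state i s) then 2 ^ i else 0)"
      by (intro sum.mono_neutral_cong_left) auto
    finally show ?thesis using card_on_tree_le[of n "Suc s"] by linarith
  qed
  have drop: "1 / 2 ^ h n (Suc s) \<le> 2 * (a (Suc s) n - a s n)" if "n \<in> ?N" for n
  proof (cases "n = s")
    case False
    with that have "Suc (h n (Suc s)) \<le> h n s" "n < s" by auto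
    then have "1 / 2 ^ h n s \<le> (1 / 2 ^ Suc (h n (Suc s)) :: real)"
      by (intro divide_left_mono power_increasing) auto
    with \<open>n < s\<close> show ?thesis by (simp add: a_def)
  qed (simp add: a_def divide_right_mono)
  have "{\<sigma>. requested s \<sigma>} = (\<Union>n\<in>?N. ?L n)"
    by (auto simp: requested_def)
  then have "(\<Sum>\<sigma> | requested s \<sigma>. 1 / 2 ^ h (length \<sigma>) (Suc s))
      = (\<Sum>n\<in>?N. \<Sum>\<sigma>\<in>?L n. 1 / 2 ^ h (length \<sigma>) (Suc s) :: real)"
    by (simp only:) (intro sum.UNION_disjoint; use fin in auto)
  also have "\<dots> = (\<Sum>n\<in>?N. real (card (?L n)) * (1 / 2 ^ h n (Suc s)))"
    by (intro sum.cong refl) simp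
  also have "\<dots> \<le> (\<Sum>n\<in>?N. ?B * (2 * (a (Suc s) n - a s n)))"
    using B by (intro sum_mono mult_mono card drop) auto
  also have "\<dots> \<le> (\<Sum>n<Suc s. ?B * (2 * (a (Suc s) n - a s n)))"
    using B a_mono[of s "Suc s"] by (intro sum_mono2) (auto intro!: mult_nonneg_nonneg)
  also have "\<dots> = 2 * (\<alpha> (Suc s) - \<alpha> s) * ?B"
    unfolding \<alpha>_eq[of s "Suc s", OF le_SucI[OF order_refl]] \<alpha>_def[of "Suc s"] sum_distrib_left[symmetric]
      sum_subtractf by simp
  finally show ?thesis .
qed

text \<open>Exchanging the sums charges each marker its kept growth: marker i costs at most 2 * 2^i
  * 4^(-i), in total at most 4. The empty set of markers contributes twice the growth of
  \<open>\<alpha>\<close>, at most 2 C.\<close>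

lemma total_weight_le:
  "(\<Sum>s<S. \<Sum>\<sigma> | requested s \<sigma>. 1 / 2 ^ h (length \<sigma>) (Suc s)) \<le> 2 * C + 4"
proof -
  let ?\<delta> = "\<lambda>s. \<alpha> (Suc s) - \<alpha> s"
  let ?k = "\<lambda>i s. keeps i s (state i s)"
  have \<delta>: "0 \<le> ?\<delta> s" for s using \<alpha>_less_Suc[of s] by simp
  have "(\<Sum>s<S. \<Sum>\<sigma> | requested s \<sigma>. 1 / 2 ^ h (length \<sigma>) (Suc s))
      \<le> (\<Sum>s<S. 2 * ?\<delta> s * (1 + (\<Sum>i<s. if ?k i s then 2 ^ i else 0)))"
    by (intro sum_mono stage_weight_le)
  also have "\<dots> \<le> (\<Sum>s<S. 2 * ?\<delta> s * (1 + (\<Sum>i<S. if ?k i s then 2 ^ i else 0)))"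
    using \<delta> by (intro sum_mono mult_left_mono add_left_mono sum_mono2) auto
  also have "\<dots> = (\<Sum>s<S. 2 * ?\<delta> s + (\<Sum>i<S. 2 * 2 ^ i * (if ?k i s then ?\<delta> s else 0)))"
    unfolding distrib_left mult_1_right sum_distrib_left
    by (intro sum.cong arg_cong2[where f = "(+)"] refl) simp
  also have "\<dots> = 2 * (\<Sum>s<S. ?\<delta> s) + (\<Sum>s<S. \<Sum>i<S. 2 * 2 ^ i * (if ?k i s then ?\<delta> s else 0))"
    by (simp only: sum.distrib sum_distrib_left)
  also have "(\<Sum>s<S. \<Sum>i<S. 2 * 2 ^ i * (if ?k i s then ?\<delta> s else 0))
      = (\<Sum>i<S. 2 * 2 ^ i * (\<Sum>s<S. if ?k i s then ?\<delta> s else 0))"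
    by (subst sum.swap) (simp add: sum_distrib_left)
  also have "\<dots> \<le> (\<Sum>i<S. 2 * 2 ^ i * (1 / 2 ^ (2 * i)))"
    by (intro sum_mono mult_left_mono kept_growth_le) simp
  also have "\<dots> = (\<Sum>i<S. 2 / 2 ^ i)"
    by (intro sum.cong refl) (simp only: mult_2 power_add, simp)
  also have "\<dots> \<le> 4"
  proof -
    have "(\<Sum>i<S. 2 / 2 ^ i) = (4 - 4 / 2 ^ S :: real)" by (induction S) (auto simp: field_simps)
    then show ?thesis by simp
  qed
  also have "(\<Sum>s<S. ?\<delta> s) = \<alpha> S - \<alpha> 0" by (rule sum_lessThan_telescope)
  finally show ?thesis using \<alpha>_le_C[of S] \<alpha>_nonneg[of 0] by simp
qed

section \<open>Limit positions of the markers\<close>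

definition limit_marker :: "nat \<Rightarrow> nat" where
  "limit_marker i = marker i (SOME S. \<forall>s\<ge>S. state i s = state i S)"

lemma limit_marker_ge: "i \<le> limit_marker i"
  by (simp add: limit_marker_def marker_def)

text \<open>A reset at a stage s' \<ge> s would move the marker beyond its limit position, and
  markers never move back. So the position itself bounds the stage of settling: limit markers below
  n are in place from stage n on.\<close>

lemma marker_eq_limit: assumes "limit_marker i \<le> s" shows "marker i s = limit_marker i"
proof -
  obtain S where S: "\<And>s. S \<le> s \<Longrightarrow> state i s = state i S" "limit_marker i = marker i S"
    using someI_ex[OF state_converges[of i]] unfolding limit_marker_def by blast
  have "state i s' = state i s" if "s \<le> s'" for s'
    using that
  proof (induction s' rule: dec_induct)
    case (step s')
    have "snd (state i (Suc s')) \<le> s"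
      using snd_state_mono[of "Suc s'" "max S (Suc s')" i] S(1)[of "max S (Suc s')"] S(2) assms
      by (simp add: marker_def)
    with step show ?case by (auto split: if_splits)
  qed simp
  from this[of "max s S"] S(1)[of "max s S"] S(2) show ?thesis by (simp add: marker_def)
qed

text \<open>By \<open>marker_eq_limit\<close> the segment is on the tree from stage n on, hence at
  every stage that can request it. The final value g is requested on entry if already reached, and
  otherwise at the last drop of h n, which comes later.\<close>

lemma requested_initial_segment:
  assumes A: "\<And>p. A p \<Longrightarrow> p \<in> range limit_marker"
    and g: "\<exists>s. h n s = g" "\<And>s. g \<le> h n s"
  shows "\<exists>s. requested s (initial_segment A n) \<and> h n (Suc s) = g"
proof -
  have on_tree: "on_tree (Suc s) (initial_segment A n)" if "n \<le> s" for s
    unfolding on_tree_def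
  proof (intro allI impI)
    fix p assume p: "p < length (initial_segment A n)" "initial_segment A n ! p"
    then have "A p" "p < n" by (auto simp: initial_segment_def)
    then obtain i where i: "p = limit_marker i" using A by blast
    then have "marker i (Suc s) = p" using \<open>p < n\<close> that by (simp add: marker_eq_limit)
    with i limit_marker_ge[of i] show "\<exists>i<Suc p. marker i (Suc s) = p"
      by (intro exI[of _ i]) auto
  qed
  have length: "length (initial_segment A n) = n" by (simp add: initial_segment_def)
  show ?thesis
  proof (cases "h n (Suc n) = g")
    case True
    then show ?thesis using on_tree[of n] length by (intro exI[of _ n]) (simp add: requested_def)
  next
    case False
    let ?m = "LEAST s. h n s = g"
    have m: "h n ?m = g" using g(1) by (rule LeastI_ex)
    have "\<not> ?m \<le> Suc n"
      using h_antimono[of ?m "Suc n" n] m g(2)[of "Suc n"] False by auto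
    then obtain s where s: "?m = Suc s" "n \<le> s" by (cases ?m) auto
    have "h n s \<noteq> g" using not_less_Least[of s "\<lambda>s. h n s = g"] s(1) by simp
    then have "h n (Suc s) < h n s" using m g(2)[of s] unfolding s(1) by simp
    then show ?thesis using on_tree[OF s(2)] s m length
      by (intro exI[of _ s]) (simp add: requested_def)
  qed
qed

section \<open>Computability of the requests and the resulting machine\<close>

context
  assumes h_computable: "computable (\<lambda>p. h (fst p) (snd p))"
    and u_computable: "computable (\<lambda>p. u (fst p) (snd p))"
begin

lemmas computable_h = computable_comp2[OF h_computable]
lemmas computable_u = computable_comp2[OF u_computable]

lemma dyadic_\<alpha>: "computable f \<Longrightarrow> dyadic (\<lambda>x. \<alpha> (f x))"
proof -
  have "dyadic \<alpha>"
    unfolding \<alpha>_def a_def by (intro computable_intros computable_h)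
  then show "computable f \<Longrightarrow> dyadic (\<lambda>x. \<alpha> (f x))" by (rule dyadic_comp)
qed

lemma dyadic_\<beta>: "computable f \<Longrightarrow> computable g \<Longrightarrow> dyadic (\<lambda>x. \<beta> (f x) (g x))"
proof -
  have "dyadic (\<lambda>p. \<beta> (fst p) (snd p))"
    unfolding \<beta>_def b_def by (intro computable_intros computable_h computable_u)
  then show "computable f \<Longrightarrow> computable g \<Longrightarrow> dyadic (\<lambda>x. \<beta> (f x) (g x))" by (rule dyadic_comp2)
qed

lemma computable_state: "computable f \<Longrightarrow> computable g \<Longrightarrow> computable (\<lambda>x. state (f x) (g x))"
proof -
  have "computable (\<lambda>p. rec_nat (0, 0)
      (\<lambda>s q. if keeps (fst p) s q then q else (snd q, Suc s)) (snd p))"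
    unfolding keeps_def by (intro computable_intros dyadic_\<alpha> dyadic_\<beta>)
  moreover have "rec_nat (0, 0) (\<lambda>s q. if keeps i s q then q else (snd q, Suc s)) s = state i s" for i s
    by (induction s) auto
  ultimately have "computable (\<lambda>p. state (fst p) (snd p))" by simp
  then show "computable f \<Longrightarrow> computable g \<Longrightarrow> computable (\<lambda>x. state (f x) (g x))" by (rule computable_comp2)
qed

lemma decidable_requested: "decidable (\<lambda>p. requested (fst p) (nat_str (snd p)))"
proof -
  have "decidable (\<lambda>q. (snd q < length (nat_str (snd (fst q))) \<and> nat_str (snd (fst q)) ! snd q) \<longrightarrow>
      (\<exists>i<Suc (snd q). marker i (Suc (fst (fst q))) = snd q))"
    unfolding marker_def by (intro computable_intros computable_state decidable_nat_str_nth)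
  then have "decidable (\<lambda>p. \<forall>k<length (nat_str (snd p)).
      (k < length (nat_str (snd p)) \<and> nat_str (snd p) ! k) \<longrightarrow>
      (\<exists>i<Suc k. marker i (Suc (fst p)) = k))"
    by (rule decidable_all_less) (intro computable_intros)
  moreover have "(\<forall>k<length \<sigma>. k < length \<sigma> \<and> \<sigma> ! k \<longrightarrow> (\<exists>i<Suc k. marker i s = k)) = on_tree s \<sigma>" for s \<sigma>
    by (auto simp: on_tree_def)
  ultimately have "decidable (\<lambda>p. on_tree (Suc (fst p)) (nat_str (snd p)))" by (simp only:)
  then show ?thesis
    unfolding requested_def by (intro computable_intros computable_h)
qed

lemma requests_machine:
  obtains M c where "prefix_free_machine M"
    "\<And>s \<sigma>. requested s \<sigma> \<Longrightarrow> \<exists>p. M p = Some \<sigma> \<and> length p = h (length \<sigma>) (Suc s) + c"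
proof -
  \<comment> \<open>Here 2 C + 4 bounds the genuine requests and 2 the padding; c scales the total
    down to 1/2.\<close>
  obtain c where "2 * (2 * C + 6) < 2 ^ c"
    using real_arch_pow[of 2 "2 * (2 * C + 6)"] by auto
  then have c: "(2 * C + 6) / 2 ^ c \<le> 1 / 2" by (simp add: field_simps)
  define f where "f q = (if requested (fst q) (nat_str (snd q))
    then 1 / 2 ^ h (length (nat_str (snd q))) (Suc (fst q)) else 0 :: real)" for q
  define r where "r j = (if requested (fst (prod_decode j)) (nat_str (snd (prod_decode j)))
    then h (length (nat_str (snd (prod_decode j)))) (Suc (fst (prod_decode j))) else j) + c" for j
  have prod_decode: "computable prod_decode"
    unfolding computable_def enc_prod_def by (simp add: recursive_nth)
  have r: "computable r"
    unfolding r_def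
    by (intro computable_intros computable_h decidable_comp[OF decidable_requested] prod_decode)
  have out: "computable (\<lambda>j. snd (prod_decode j))"
    by (intro computable_intros prod_decode)
  have weight: "(\<Sum>j<J. 1 / 2 ^ r j) \<le> (1 / 2 :: real)" for J
  proof -
    have "(\<Sum>j<J. 1 / 2 ^ r j) \<le> (\<Sum>j<J. f (prod_decode j) / 2 ^ c + 1 / 2 ^ j / 2 ^ c)"
      by (intro sum_mono) (auto simp: r_def f_def power_add)
    also have "\<dots> = ((\<Sum>j<J. f (prod_decode j)) + (\<Sum>j<J. 1 / 2 ^ j)) / 2 ^ c"
      by (simp add: sum.distrib add_divide_distrib sum_divide_distrib)
    also have "\<dots> \<le> ((2 * C + 4) + 2) / 2 ^ c"
    proof (intro divide_right_mono add_mono)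
      have "(\<Sum>j<J. f (prod_decode j)) \<le> (\<Sum>s<J. \<Sum>x<J. f (s, x))"
        by (rule sum_prod_decode_le) (simp add: f_def)
      also have "\<dots> \<le> (\<Sum>s<J. \<Sum>\<sigma> | requested s \<sigma>. 1 / 2 ^ h (length \<sigma>) (Suc s))"
      proof (rule sum_mono)
        fix s
        have fin: "finite {\<sigma>. requested s \<sigma>}"
          by (rule finite_subset[OF _ finite_lists_length_le[of "UNIV :: bool set" s]])
            (auto simp: requested_def)
        have inj: "inj_on nat_str X" for X by (metis inj_onI str_code_nat_str)
        have "(\<Sum>x<J. f (s, x)) = (\<Sum>x | x < J \<and> requested s (nat_str x). 1 / 2 ^ h (length (nat_str x)) (Suc s))"
          unfolding f_def by (intro sum.mono_neutral_cong_right) auto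
        also have "\<dots> = (\<Sum>\<sigma>\<in>nat_str ` {x. x < J \<and> requested s (nat_str x)}. 1 / 2 ^ h (length \<sigma>) (Suc s))"
          by (simp add: sum.reindex[OF inj])
        also have "\<dots> \<le> (\<Sum>\<sigma> | requested s \<sigma>. 1 / 2 ^ h (length \<sigma>) (Suc s))"
          using fin by (intro sum_mono2) auto
        finally show "(\<Sum>x<J. f (s, x)) \<le> (\<Sum>\<sigma> | requested s \<sigma>. 1 / 2 ^ h (length \<sigma>) (Suc s))" .
      qed
      also have "\<dots> \<le> 2 * C + 4" by (rule total_weight_le)
      finally show "(\<Sum>j<J. f (prod_decode j)) \<le> 2 * C + 4" .
      have "(\<Sum>j<J. 1 / 2 ^ j) = (2 - 2 / 2 ^ J :: real)" by (induction J) (auto simp: field_simps)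
      then show "(\<Sum>j<J. 1 / 2 ^ j) \<le> (2 :: real)" by simp
    qed simp
    also have "\<dots> \<le> 1 / 2" using c by (simp add: add.assoc)
    finally show ?thesis .
  qed
  obtain M where M: "prefix_free_machine M"
    "\<And>j. \<exists>p. M p = Some (nat_str (snd (prod_decode j))) \<and> length p = r j"
    using prefix_free_machine_of_requests[OF r out weight] by blast
  have "\<exists>p. M p = Some \<sigma> \<and> length p = h (length \<sigma>) (Suc s) + c" if "requested s \<sigma>" for s \<sigma>
    using M(2)[of "prod_encode (s, str_code \<sigma>)"] that by (simp add: r_def)
  with M(1) show thesis by (rule that)
qed

end

end


section \<open>The theorem\<close>

lemma uncountable_subsets:
  fixes B :: "nat set"
  assumes "infinite B"
  shows "uncountable {A. \<forall>p. A p \<longrightarrow> p \<in> B}"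
proof
  assume count: "countable {A. \<forall>p. A p \<longrightarrow> p \<in> B}"
  define F where "F = from_nat_into {A. \<forall>p. A p \<longrightarrow> p \<in> B}"
  define D where "D p \<longleftrightarrow> (\<exists>k. p = enumerate B k \<and> \<not> F k p)" for p
  have "D \<in> {A. \<forall>p. A p \<longrightarrow> p \<in> B}"
    using assms by (auto simp: D_def enumerate_in_set)
  then obtain k where "F k = D"
    using from_nat_into_surj[OF count] unfolding F_def by blast
  moreover have "D (enumerate B k) \<longleftrightarrow> \<not> F k (enumerate B k)"
    using inj_eq[OF strict_mono_imp_inj_on[OF strict_mono_enumerate[OF assms]]] by (auto simp: D_def)
  ultimately show False by simp
qed

lemma computable2_imp_computable:
  assumes "computable2 h" shows "computable (\<lambda>p. h (fst p) (snd p))"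
proof -
  have "recursive 2 (\<lambda>xs. h (xs ! 0) (xs ! 1))"
    using assms unfolding computable2_def partial_recursive_def recursive_def by auto
  then have "recursive 1 (\<lambda>xs. h (fst (prod_decode (xs ! 0))) (snd (prod_decode (xs ! 0))))"
    by (rule recursive_comp2) (intro recursive_prod_decode recursive_nth; simp)+
  then show ?thesis by (simp add: computable_def dec_prod)
qed

theorem mainTheorem12:
  fixes U :: machine and g :: "nat \<Rightarrow> nat"
  assumes "optimal_prefix_free_machine U"
    and "right_ce g"
    and "\<exists>c. \<forall>n. K_nat U n \<le> g n + c"
    and "\<not> weak_solovay U g"
  shows "uncountable {A :: nat \<Rightarrow> bool. \<exists>c. \<forall>n. K U (initial_segment A n) \<le> g n + c}"
proof -
  obtain h where h: "computable2 h" "\<And>n. decseq (h n)" "\<And>n. h n \<longlonglongrightarrow> g n"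
    using assms(2) unfolding right_ce_def by blast
  have g_le: "g n \<le> h n s" for n s
    using h(2,3) by (rule decseq_ge)
  have g_ex: "\<exists>s. h n s = g n" for n
    using tendsto_discrete[of "h n" "g n" sequentially] h(3)[of n]
    by (auto simp: eventually_sequentially)
  obtain d where d: "\<And>n. K_nat U n \<le> g n + d" using assms(3) by blast
  have U: "prefix_free_machine U"
    using assms(1) unfolding optimal_prefix_free_machine_def by blast
  obtain u :: "nat \<Rightarrow> nat \<Rightarrow> nat" where u: "computable (\<lambda>p. u (fst p) (snd p))"
    "\<And>s s' x y. u s x = Suc y \<Longrightarrow> s \<le> s' \<Longrightarrow> u s' x = Suc y"
    "\<And>x y. (\<exists>s. u s x = Suc y) \<longleftrightarrow> U (nat_str x) = Some (nat_str y)"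
    using prefix_free_machine_enumeration[OF U] by blast
  interpret gap_approximation h u "2 ^ d"
  proof
    show "h n s' \<le> h n s" if "s \<le> s'" for s s' n
      using h(2)[of n] that by (simp add: decseq_def)
    show "x = x'" if "0 < u s x" "0 < u s x'" "prefix (nat_str x) (nat_str x')" for s x x'
    proof -
      have "u s x = Suc (u s x - 1)" "u s x' = Suc (u s x' - 1)" using that by auto
      then have "nat_str x \<in> dom U" "nat_str x' \<in> dom U" using u(3) by blast+
      with U that(3) have "nat_str x = nat_str x'" unfolding prefix_free_machine_def by blast
      then show ?thesis by (metis str_code_nat_str)
    qed
    show "(\<Sum>n<s. 1 / 2 ^ h n s) \<le> (2 ^ d :: real)" for s
    proof -
      have "1 / 2 ^ h n s \<le> 2 ^ d * (1 / 2 ^ K_nat U n :: real)" for n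
      proof -
        have "K_nat U n \<le> h n s + d" using d[of n] g_le[of n s] by simp
        then have "(2 :: real) ^ K_nat U n \<le> 2 ^ (h n s + d)" by (intro power_increasing) auto
        then show ?thesis by (simp add: power_add field_simps)
      qed
      then have "(\<Sum>n<s. 1 / 2 ^ h n s) \<le> 2 ^ d * (\<Sum>n<s. 1 / 2 ^ K_nat U n :: real)"
        unfolding sum_distrib_left by (intro sum_mono)
      also have "\<dots> \<le> 2 ^ d * 1"
        by (intro mult_left_mono sum_K_nat_le_1 assms(1)) simp
      finally show ?thesis by simp
    qed
    show "\<exists>N. \<forall>n\<ge>N. \<exists>x s. u s x = Suc n \<and> (\<forall>t. length (nat_str x) + k \<le> h n t)" for k
    proof -
      have "finite {n. g n \<le> K_nat U n + k}"
        using assms(2-4) unfolding weak_solovay_def by blast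
      then obtain N where N: "\<forall>n\<in>{n. g n \<le> K_nat U n + k}. n < N"
        using finite_nat_set_iff_bounded by blast
      have "\<exists>x s. u s x = Suc n \<and> (\<forall>t. length (nat_str x) + k \<le> h n t)" if n: "N \<le> n" for n
      proof -
        obtain p where p: "U p = Some (nat_str n)" "length p = K_nat U n"
          using optimal_machine_range[OF assms(1)] unfolding K_nat_def by blast
        then obtain s where s: "u s (str_code p) = Suc n" using u(3)[of "str_code p" n] by auto
        have "\<not> g n \<le> K_nat U n + k" using N n by auto
        then have "K_nat U n + k \<le> h n t" for t using g_le[of n t] by simp
        with s p show ?thesis by (intro exI[of _ "str_code p"] exI[of _ s]) auto
      qed
      then show ?thesis by blast
    qed
  qed (use u(2) in blast)
  obtain M c where M: "prefix_free_machine M"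
    "\<And>s \<sigma>. requested s \<sigma> \<Longrightarrow> \<exists>p. M p = Some \<sigma> \<and> length p = h (length \<sigma>) (Suc s) + c"
    using requests_machine[OF computable2_imp_computable[OF h(1)] u(1)] by blast
  obtain c' where c': "\<And>p s. M p = Some s \<Longrightarrow> K U s \<le> length p + c'"
    using K_le_machine[OF assms(1) M(1)] by blast
  have "K U (initial_segment A n) \<le> g n + (c + c')" if A: "\<forall>p. A p \<longrightarrow> p \<in> range limit_marker" for A n
  proof -
    obtain s where s: "requested s (initial_segment A n)" "h n (Suc s) = g n"
      using requested_initial_segment[of A n "g n"] A g_ex g_le by blast
    obtain p where "M p = Some (initial_segment A n)" "length p = g n + c"
      using M(2)[OF s(1)] s(2) by (auto simp: initial_segment_def)
    with c' show ?thesis by fastforce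
  qed
  then have "{A. \<forall>p. A p \<longrightarrow> p \<in> range limit_marker}
      \<subseteq> {A. \<exists>c. \<forall>n. K U (initial_segment A n) \<le> g n + c}"
    by blast
  moreover have "infinite (range limit_marker)"
    unfolding infinite_nat_iff_unbounded_le using limit_marker_ge by blast
  ultimately show ?thesis using uncountable_subsets countable_subset by blast
qed

end
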